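(* Let $B$ be a one-dimensional standard Brownian motion and $U(t):=e^{-t/2}B(e^t)$ an Ornstein–Uhlenbeck process on $\mathbb{R}$. Then the tall peaks of $B$ are a monofractal, whereas those of $U$ are multifractal, in the following sense: for every $\gamma>0$, $$\operatorname{Dim}_{\rm H}\left\{s\ge e^e:\ \frac{B(s)}{(2s\log\log s)^{1/2}}\ge\gamma\right\}=\begin{cases}1&\text{if }\gamma\le1,\\0&\text{if }\gamma>1,\end{cases}$$ almost surely, whereas $$\operatorname{Dim}_{\rm H}\left\{s\ge e^e:\ \frac{U(s)}{(2\log s)^{1/2}}\ge\gamma\right\}=1-\gamma^2$$ almost surely, where in the latter display, when $1-\gamma^2<0$, the assertion means that the set is bounded.
   Context: Macroscopic (Barlow–Taylor) Hausdorff dimension: in $\mathbb{R}^d$ let $\mathcal{V}_n:=[-e^n,e^n)^d$ for $n\ge0$, $\mathcal{S}_0:=\mathcal{V}_0$, $\mathcal{S}_{n+1}:=\mathcal{V}_{n+1}\setminus\mathcal{V}_n$. An upright box is a set $Q(x,r)=[x_1,x_1+r)\times\cdots\times[x_d,x_d+r)$, $x\in\mathbb{R}^d$, $r>0$; its side is $r$. For $E\subseteq\mathbb{R}^d$, $\rho>0$, let $\nu^n_\rho(E):=\inf\sum_{i=1}^m(\mathrm{side}(Q_i)/e^n)^\rho$, the infimum over all finite covers of $E\cap\mathcal{S}_n$ by upright boxes $Q_1,\dots,Q_m$ of side $\ge1$. Then $\operatorname{Dim}_{\rm H}E:=\inf\{\rho>0:\sum_{n=1}^\infty\nu^n_\rho(E)<\infty\}$.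 Here $d=1$. The words "monofractal" and "multifractal" are to be read as abbreviations of the two displayed dimension formulas. *)

theory Defs
  imports "HOL-Probability.Probability"
begin

definition upright_box :: "'a::euclidean_space \<Rightarrow> real \<Rightarrow> 'a set" where
  "upright_box x r = {y. \<forall>b\<in>Basis. x \<bullet> b \<le> y \<bullet> b \<and> y \<bullet> b < x \<bullet> b + r}"

definition macro_cube :: "nat \<Rightarrow> 'a::euclidean_space set" where
  "macro_cube n = {y. \<forall>b\<in>Basis. - exp (real n) \<le> y \<bullet> b \<and> y \<bullet> b < exp (real n)}"

fun macro_shell :: "nat \<Rightarrow> 'a::euclidean_space set" where
  "macro_shell 0 = macro_cube 0"
| "macro_shell (Suc n) = macro_cube (Suc n) - macro_cube n"

definition macro_content :: "real \<Rightarrow> nat \<Rightarrow> 'a::euclidean_space set \<Rightarrow> ennreal" where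
  "macro_content \<rho> n E =
     Inf {ennreal (\<Sum>i<m. (r i / exp (real n)) powr \<rho>) | (m::nat) (x :: nat \<Rightarrow> 'a) (r :: nat \<Rightarrow> real).
            (\<forall>i<m. r i \<ge> 1) \<and> E \<inter> macro_shell n \<subseteq> (\<Union>i<m. upright_box (x i) (r i))}"

definition Dim_H :: "'a::euclidean_space set \<Rightarrow> ereal" where
  "Dim_H E = Inf (ereal ` {\<rho>. \<rho> > 0 \<and> (\<Sum>n. macro_content \<rho> (Suc n) E) < \<infinity>})"

text \<open>The time set is \<^term>\<open>{0::real..}\<close>; the values of \<open>B\<close> at negative times are irrelevant.\<close>

locale standard_brownian_motion = prob_space M
  for M :: "'a measure" and B :: "real \<Rightarrow> 'a \<Rightarrow> real" +
  assumes measurable_B: "t \<ge> 0 \<Longrightarrow> B t \<in> borel_measurable M"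
    and start_zero: "AE \<omega> in M. B 0 \<omega> = 0"
    and indep_increments:
      "\<lbrakk>0 \<le> \<tau> 0; \<forall>i<n. \<tau> i < \<tau> (Suc i)\<rbrakk> \<Longrightarrow>
         indep_vars (\<lambda>_. borel) (\<lambda>i \<omega>. B (\<tau> (Suc i)) \<omega> - B (\<tau> i) \<omega>) {..<(n::nat)}"
    and normal_increments:
      "\<lbrakk>0 \<le> s; s < t\<rbrakk> \<Longrightarrow>
         distributed M lborel (\<lambda>\<omega>. B t \<omega> - B s \<omega>) (normal_density 0 (sqrt (t - s)))"
    and continuous_paths: "AE \<omega> in M. continuous_on {0..} (\<lambda>t. B t \<omega>)"

definition ornstein_uhlenbeck :: "(real \<Rightarrow> 'a \<Rightarrow> real) \<Rightarrow> real \<Rightarrow> 'a \<Rightarrow> real" where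
  "ornstein_uhlenbeck B t \<omega> = exp (- t / 2) * B (exp t) \<omega>"

end

theory Submission
  imports Defs "HOL-Real_Asymp.Real_Asymp"
begin

text \<open>
  Upper bounds come from the maximal inequality on windows \<open>[exp (i / m), exp ((i + 1) / m))\<close>: a peak of
  height \<open>\<gamma>\<close> occurs there with probability at most \<open>2 (i / m)\<^bsup>-c\<^esup>\<close> with \<open>c\<close> close to \<open>\<gamma>\<^sup>2\<close>.
  For \<open>\<gamma> > 1\<close> this is summable and both peak sets are bounded; for \<open>\<gamma> \<le> 1\<close> the expected number of unit
  windows with a peak of \<open>U\<close> in the \<open>n\<close>-th shell is about \<open>exp (n (1 - \<gamma>\<^sup>2))\<close>.

  Lower bounds only use points, because covering boxes have side at least \<open>1\<close>. For \<open>U\<close>, the increments of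
  \<open>B\<close> over \<open>[exp (g i), exp (g (i + 1))]\<close> are independent, and for \<open>\<beta> > \<gamma>\<^sup>2\<close> almost surely every block of
  length about \<open>exp (n \<beta>)\<close> in the \<open>n\<close>-th shell eventually contains a peak.
  For \<open>B\<close> it suffices to treat \<open>\<gamma> = 1\<close>. The \<open>\<rho>\<close>-content of the \<open>n\<close>-th shell is, for \<open>\<rho> \<le> 1\<close>, at least half
  the proportion of integer points that are peaks; its expectation is of order \<open>1 / (n sqrt (ln n))\<close>.
  Along shells with gaps of order \<open>sqrt (ln n)\<close> these proportions can be replaced by independent ones,
  and the sum of their expectations still diverges, like that of \<open>1 / (j ln j)\<close>.
\<close>

subsection \<open>Macroscopic Hausdorff dimension on the line\<close>

text \<open>The contrast comes from the time scale. In logarithmic time \<open>u = ln s\<close> a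
  shell for \<open>B\<close> is a single interval of length 1, while a shell for \<open>U\<close>
  holds about \<open>exp n\<close> nearly independent windows. For \<open>U\<close> the number of
  successful windows has an exponent that varies with \<gamma>; for \<open>B\<close> all depends on
  whether shells with many peaks keep recurring, and this switches at \<gamma> = 1. Level 1 for
  \<open>B\<close> is critical: a fixed relative error in the threshold would change the power of
  \<open>n\<close>, so only a bounded error in the squared standardised threshold is affordable.
  Infinitely many peaks alone would not make the contents sum to infinity, hence the work with
  proportions of integer points and their expectations. Both lower bounds decouple in the same way.
  An increment from time \<open>a\<close> must exceed the boundary plus a slack, and a
  Borel-Cantelli argument shows that \<open>B a\<close> is eventually not negative enough to use up
  the slack.\<close>

lemma upright_box_real: "upright_box (x::real) r = {x..<x + r}"
  by (auto simp: upright_box_def)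

lemma macro_shell_Suc_real:
  "(s::real) \<in> macro_shell (Suc n) \<longleftrightarrow>
     - exp (real (Suc n)) \<le> s \<and> s < exp (real (Suc n)) \<and> (s < - exp (real n) \<or> exp (real n) \<le> s)"
  by (auto simp: macro_cube_def)

lemma nonneg_in_macro_shell_Suc:
  assumes "0 \<le> (s::real)"
  shows "s \<in> macro_shell (Suc n) \<longleftrightarrow> exp (real n) \<le> s \<and> s < exp (real (Suc n))"
proof -
  have "- exp (real (Suc n)) \<le> s" "\<not> s < - exp (real n)"
    using assms exp_gt_zero[of "real (Suc n)"] exp_gt_zero[of "real n"] by linarith+
  then show ?thesis
    unfolding macro_shell_Suc_real by blast
qed

text \<open>Upper bounds only use boxes of the least admissible side 1, each of cost
  \<open>exp (- real n * \<rho>)\<close>.\<close>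

lemma macro_content_le:
  fixes E :: "real set"
  assumes I: "finite I" and cov: "E \<inter> macro_shell n \<subseteq> (\<Union>x\<in>I. {x..<x + 1})"
  shows "macro_content \<rho> n E \<le> ennreal (real (card I) * exp (- real n * \<rho>))"
proof -
  obtain f where f: "bij_betw f {..<card I} I"
    using ex_bij_betw_nat_finite[OF I] by (auto simp: atLeast0LessThan)
  have "(\<Union>x\<in>f ` {..<card I}. {x..<x + 1}) = (\<Union>i<card I. upright_box (f i) 1)"
    by (simp add: upright_box_real)
  then have "(\<Union>x\<in>I. {x..<x + 1}) = (\<Union>i<card I. upright_box (f i) 1)"
    unfolding bij_betw_imp_surj_on[OF f] .
  then have "macro_content \<rho> n E \<le> ennreal (\<Sum>i<card I. (1 / exp (real n)) powr \<rho>)"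
    unfolding macro_content_def using cov
    by (intro Inf_lower CollectI exI[of _ "card I"] exI[of _ f] exI[of _ "\<lambda>_. 1"]) simp
  also have "(1 / exp (real n)) powr \<rho> = exp (- real n * \<rho>)"
    by (simp add: powr_def ln_div)
  finally show ?thesis
    by simp
qed

text \<open>Mass distribution principle for the counting measure on \<open>P\<close>: a cover must
  capture all of \<open>P\<close>, and each box captures at most \<open>C\<close> times its own
  cost.\<close>

lemma macro_content_ge:
  fixes E :: "real set"
  assumes P: "finite P" "P \<subseteq> E \<inter> macro_shell n" and C: "0 < C"
    and card: "\<And>x r. 1 \<le> r \<Longrightarrow> real (card (P \<inter> {x..<x + r})) \<le> C * (r / exp (real n)) powr \<rho>"
  shows "ennreal (real (card P) / C) \<le> macro_content \<rho> n E"
  unfolding macro_content_def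
proof (rule Inf_greatest, clarify)
  fix m :: nat and x r :: "nat \<Rightarrow> real"
  assume r: "\<forall>i<m. 1 \<le> r i" and cov: "E \<inter> macro_shell n \<subseteq> (\<Union>i<m. upright_box (x i) (r i))"
  have "P = (\<Union>i<m. P \<inter> {x i..<x i + r i})"
    using P cov unfolding upright_box_real by blast
  then have "card P \<le> (\<Sum>i<m. card (P \<inter> {x i..<x i + r i}))"
    using card_UN_le[of "{..<m}" "\<lambda>i. P \<inter> {x i..<x i + r i}"] by simp
  then have "real (card P) \<le> (\<Sum>i<m. real (card (P \<inter> {x i..<x i + r i})))"
    by (metis of_nat_le_iff of_nat_sum)
  also have "\<dots> \<le> (\<Sum>i<m. C * (r i / exp (real n)) powr \<rho>)"
    using r by (intro sum_mono card) auto
  finally have "real (card P) / C \<le> (\<Sum>i<m. (r i / exp (real n)) powr \<rho>)"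
    using C by (simp add: field_simps sum_distrib_left)
  then show "ennreal (real (card P) / C) \<le> ennreal (\<Sum>i<m. (r i / exp (real n)) powr \<rho>)"
    by (rule ennreal_leI)
qed

lemma macro_shell_covered:
  obtains I :: "real set" where "finite I" "card I \<le> 2 * nat \<lceil>exp (real n)\<rceil>" "macro_shell n \<subseteq> (\<Union>x\<in>I. {x..<x + 1})"
proof -
  define N where "N = \<lceil>exp (real n)\<rceil>"
  have N: "0 \<le> N"
    using exp_gt_zero[of "real n"] unfolding N_def by linarith
  define I where "I = real_of_int ` {-N..<N}"
  have "card I \<le> card {-N..<N}"
    unfolding I_def by (rule card_image_le) simp
  then have "card I \<le> 2 * nat N"
    using N by (simp add: nat_mult_distrib)
  moreover have "macro_shell n \<subseteq> (\<Union>x\<in>I. {x..<x + 1})"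
  proof
    fix s :: real assume "s \<in> macro_shell n"
    then have "s \<in> macro_cube n"
      by (cases n) auto
    then have "- exp (real n) \<le> s" "s < exp (real n)"
      by (auto simp: macro_cube_def)
    then have "- real_of_int N \<le> s" "s < real_of_int N"
      unfolding N_def by linarith+
    then have "\<lfloor>s\<rfloor> \<in> {-N..<N}"
      by (auto simp: le_floor_iff floor_less_iff)
    then show "s \<in> (\<Union>x\<in>I. {x..<x + 1})"
      unfolding I_def by (intro UN_I[of "real_of_int \<lfloor>s\<rfloor>"]) auto
  qed
  ultimately show thesis
    by (intro that[of I]) (auto simp: I_def N_def)
qed

text \<open>Unit boxes covering the whole shell. Summed over \<open>n\<close> with \<rho> > 1 this
  bounds every dimension by 1; for a single \<open>n\<close> it shows that the content is
  finite.\<close>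

lemma macro_content_le_exp:
  fixes E :: "real set"
  shows "macro_content \<rho> n E \<le> ennreal (4 * exp (1 - \<rho>) ^ n)"
proof -
  obtain I :: "real set" where I: "finite I" "card I \<le> 2 * nat \<lceil>exp (real n)\<rceil>"
    "macro_shell n \<subseteq> (\<Union>x\<in>I. {x..<x + 1})"
    by (rule macro_shell_covered)
  have "real (card I) \<le> 2 * real (nat \<lceil>exp (real n)\<rceil>)"
    using I(2) by linarith
  also have "\<dots> \<le> 2 * (exp (real n) + 1)"
    using exp_gt_zero[of "real n"] by (simp del: exp_gt_zero) linarith
  also have "\<dots> \<le> 4 * exp (real n)"
    by simp
  finally have "real (card I) * exp (- real n * \<rho>) \<le> 4 * exp (real n) * exp (- real n * \<rho>)"
    by (intro mult_right_mono) auto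
  also have "\<dots> = 4 * exp (1 - \<rho>) ^ n"
    by (simp add: exp_of_nat_mult[symmetric] mult_exp_exp algebra_simps)
  finally have "ennreal (real (card I) * exp (- real n * \<rho>)) \<le> ennreal (4 * exp (1 - \<rho>) ^ n)"
    by (rule ennreal_leI)
  moreover have "macro_content \<rho> n E \<le> ennreal (real (card I) * exp (- real n * \<rho>))"
    using I by (intro macro_content_le) auto
  ultimately show ?thesis
    by (rule order.trans[rotated])
qed

lemma Dim_H_le:
  assumes "0 < \<rho>" "(\<Sum>n. macro_content \<rho> (Suc n) E) < \<infinity>"
  shows "Dim_H E \<le> ereal \<rho>"
  unfolding Dim_H_def using assms by (intro Inf_lower) auto

lemma Dim_H_ge:
  assumes "\<And>\<rho>. 0 < \<rho> \<Longrightarrow> \<rho> < D \<Longrightarrow> (\<Sum>n. macro_content \<rho> (Suc n) E) = \<infinity>"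
  shows "ereal D \<le> Dim_H E"
  unfolding Dim_H_def using assms by (intro Inf_greatest) (force simp: not_le[symmetric])

text \<open>Almost sure summability is obtained for countably many exponents at a time, so upper
  bounds approach \<open>D\<close> along this sequence.\<close>

lemma Dim_H_le_of_seq:
  assumes "\<And>k. Dim_H E \<le> ereal (D + 1 / real (Suc k))"
  shows "Dim_H E \<le> ereal D"
proof (rule LIMSEQ_le_const)
  have "(\<lambda>k. D + 1 / real (Suc k)) \<longlonglongrightarrow> D + 0"
    by (intro tendsto_intros LIMSEQ_Suc[OF lim_1_over_n])
  then show "(\<lambda>k. ereal (D + 1 / real (Suc k))) \<longlonglongrightarrow> ereal D"
    by simp
  show "\<exists>N. \<forall>n\<ge>N. Dim_H E \<le> ereal (D + 1 / real (Suc n))"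
    using assms by blast
qed

lemma Dim_H_le_1: "Dim_H (E :: real set) \<le> 1"
proof -
  have "Dim_H E \<le> ereal (1 + 1 / real (Suc k))" for k
  proof (rule Dim_H_le)
    define q where "q = exp (- 1 / real (Suc k))"
    have q: "0 \<le> q" "q < 1"
      by (auto simp: q_def)
    have "macro_content (1 + 1 / real (Suc k)) (Suc n) E \<le> ennreal (4 * q ^ Suc n)" for n
      using macro_content_le_exp[of "1 + 1 / real (Suc k)" "Suc n" E] by (simp add: q_def)
    then have "(\<Sum>n. macro_content (1 + 1 / real (Suc k)) (Suc n) E) \<le> (\<Sum>n. ennreal (4 * q ^ Suc n))"
      by (intro suminf_le) auto
    also have "\<dots> < \<infinity>"
      using q by (subst suminf_ennreal2) (auto simp: summable_mult summable_Suc_iff simp del: power_Suc)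
    finally show "(\<Sum>n. macro_content (1 + 1 / real (Suc k)) (Suc n) E) < \<infinity>" .
  qed (auto intro: add_pos_pos)
  then show ?thesis
    using Dim_H_le_of_seq[of E 1] by (simp add: one_ereal_def)
qed

lemma Dim_H_nonneg: "0 \<le> Dim_H E"
  using Dim_H_ge[of 0 E] by (simp add: zero_ereal_def)

lemma Dim_H_bounded:
  assumes "bounded (E :: real set)"
  shows "Dim_H E = 0"
proof (rule antisym[OF _ Dim_H_nonneg])
  obtain b where b: "\<And>s. s \<in> E \<Longrightarrow> \<bar>s\<bar> \<le> b"
    using assms by (auto simp: bounded_iff)
  define m where "m = nat \<lceil>b\<rceil>"
  have 0: "macro_content \<rho> (Suc n) E = 0" if "m \<le> n" for \<rho> n
  proof -
    have "b < exp (real n)"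
    proof -
      have "b \<le> real n"
        using that unfolding m_def by linarith
      also have "\<dots> < exp (real n)"
        using exp_ge_add_one_self[of "real n"] by linarith
      finally show ?thesis .
    qed
    then have "E \<inter> macro_shell (Suc n) = {}"
      using b by (fastforce simp: macro_shell_Suc_real simp del: macro_shell.simps)
    then show ?thesis
      using macro_content_le[of "{}" E "Suc n" \<rho>] by simp
  qed
  have "Dim_H E \<le> ereal (0 + 1 / real (Suc k))" for k
  proof (rule Dim_H_le)
    let ?\<rho> = "0 + 1 / real (Suc k)"
    have "(\<Sum>n. macro_content ?\<rho> (Suc n) E) = (\<Sum>n<m. macro_content ?\<rho> (Suc n) E)"
      using 0 by (intro suminf_finite) auto
    also have "\<dots> < \<infinity>"
      using order.strict_trans1[OF macro_content_le_exp ennreal_less_top] by simp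
    finally show "(\<Sum>n. macro_content ?\<rho> (Suc n) E) < \<infinity>" .
  qed simp
  then show "Dim_H E \<le> 0"
    using Dim_H_le_of_seq[of E 0] by (simp add: zero_ereal_def)
qed

section \<open>Lower bounds for contents by counting points in boxes\<close>

lemma card_le_of_diff_le:
  fixes J :: "nat set"
  assumes "finite J" "0 \<le> d" and diff: "\<And>i j. i \<in> J \<Longrightarrow> j \<in> J \<Longrightarrow> real j - real i \<le> d"
  shows "real (card J) \<le> d + 1"
proof (cases "J = {}")
  case False
  have "card J \<le> card {Min J..Max J}"
    using assms(1) by (intro card_mono) auto
  then have "real (card J) \<le> real (Max J) - real (Min J) + 1"
    using Min_le[OF assms(1) Max_in[OF assms(1) False]] by (simp add: of_nat_diff)
  then show ?thesis
    using diff[OF Min_in[OF assms(1) False] Max_in[OF assms(1) False]] by linarith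
qed (use assms in auto)

text \<open>A box of side \<open>r\<close> meets at most \<open>r / L + 2\<close> of the blocks of length \<open>L\<close>, which is bounded
  by the \<open>\<rho>\<close>-cost of the box because \<open>r \<ge> 1\<close>.\<close>

lemma macro_content_ge_blocks:
  fixes E :: "real set"
  assumes J: "finite J" and L: "0 < L" and \<rho>: "0 < \<rho>" "\<rho> \<le> 1"
    and u: "\<And>j. j \<in> J \<Longrightarrow> u j \<in> E \<inter> macro_shell n"
    and block: "\<And>j. j \<in> J \<Longrightarrow> L * real j < u j \<and> u j \<le> L * (real j + 1)"
  shows "ennreal (real (card J) / (exp (real n) / L + 2 * exp (real n * \<rho>))) \<le> macro_content \<rho> n E"
proof -
  have mono: "j \<le> i" if "i \<in> J" "j \<in> J" "u j \<le> u i" for i j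
  proof (rule ccontr)
    assume "\<not> j \<le> i"
    then have "L * (real i + 1) \<le> L * real j"
      using L by (intro mult_left_mono) auto
    then show False
      using block[OF that(1)] block[OF that(2)] that(3) by linarith
  qed
  have inj: "inj_on u J"
    by (intro inj_onI) (metis mono order.refl order.antisym)
  have count: "real (card (u ` J \<inter> {x..<x + r})) \<le> r / L + 2" if "0 \<le> r" for x r
  proof -
    have "card (u ` J \<inter> {x..<x + r}) = card {j\<in>J. u j \<in> {x..<x + r}}"
    proof -
      have "u ` J \<inter> {x..<x + r} = u ` {j\<in>J. u j \<in> {x..<x + r}}"
        by auto
      then show ?thesis
        using card_image[OF inj_on_subset[OF inj]] by simp
    qed
    moreover have "real (card {j\<in>J. u j \<in> {x..<x + r}}) \<le> (r / L + 1) + 1"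
    proof (rule card_le_of_diff_le)
      fix i j assume ij: "i \<in> {j\<in>J. u j \<in> {x..<x + r}}" "j \<in> {j\<in>J. u j \<in> {x..<x + r}}"
      then have "L * real j - L * (real i + 1) \<le> r"
        using block[of i] block[of j] by auto
      then have "(L * (real j - real i - 1)) / L \<le> r / L"
        using L by (intro divide_right_mono) (auto simp: algebra_simps)
      then show "real j - real i \<le> r / L + 1"
        using L by simp
    qed (use J L that in auto)
    ultimately show ?thesis
      by simp
  qed
  \<comment> \<open>The two summands pay for the two terms of the count \<open>r / L + 2\<close>.
    With \<open>w = r / exp n \<le> 1\<close> the first uses \<open>w \<le> w powr \<rho>\<close>,
    and the second uses \<open>w \<ge> exp (- n)\<close>, that is \<open>r \<ge> 1\<close>.\<close>
  define C where "C = exp (real n) / L + 2 * exp (real n * \<rho>)"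
  have C: "0 < C"
    using L by (auto simp: C_def intro!: add_pos_pos)
  have "ennreal (real (card (u ` J)) / C) \<le> macro_content \<rho> n E"
  proof (rule macro_content_ge)
    fix x r :: real assume r: "1 \<le> r"
    show "real (card (u ` J \<inter> {x..<x + r})) \<le> C * (r / exp (real n)) powr \<rho>"
    proof (cases "r \<le> exp (real n)")
      case True
      define w where "w = r / exp (real n)"
      have w: "0 < w" "w \<le> 1" "exp (- real n) \<le> w"
        using r True by (auto simp: w_def exp_minus field_simps)
      have "w powr 1 \<le> w powr \<rho>"
        using w \<rho> by (intro powr_mono') auto
      then have "exp (real n) / L * w \<le> exp (real n) / L * w powr \<rho>"
        using w L by (intro mult_left_mono) auto
      moreover have "exp (- real n) powr \<rho> \<le> w powr \<rho>"
        using w \<rho> by (intro powr_mono2) auto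
      then have "2 * exp (real n * \<rho>) * exp (- real n) powr \<rho> \<le> 2 * exp (real n * \<rho>) * w powr \<rho>"
        by (intro mult_left_mono) auto
      moreover have "2 * exp (real n * \<rho>) * exp (- real n) powr \<rho> = 2"
        by (simp add: powr_def mult.commute flip: exp_add)
      ultimately have "exp (real n) / L * w + 2 \<le> C * w powr \<rho>"
        by (simp add: C_def distrib_right)
      moreover have "exp (real n) / L * w = r / L"
        by (simp add: w_def)
      ultimately show ?thesis
        using count[of r x] r unfolding w_def by linarith
    next
      case False
      \<comment> \<open>A box wider than \<open>exp n\<close> captures no more points than
        \<open>{0..<exp n}\<close>, which contains them all, while its cost is at least 1.\<close>
      have "u j \<in> {0..<0 + exp (real n)}" if "j \<in> J" for j
      proof -
        have "0 \<le> L * real j"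
          using L by simp
        then have "0 \<le> u j"
          using block[OF that] by linarith
        moreover have "u j \<in> macro_cube n"
          using u[OF that] by (cases n) auto
        then have "u j < exp (real n)"
          by (simp add: macro_cube_def)
        ultimately show ?thesis
          by simp
      qed
      then have "card (u ` J \<inter> {x..<x + r}) \<le> card (u ` J \<inter> {0..<0 + exp (real n)})"
        using J by (intro card_mono) auto
      then have "real (card (u ` J \<inter> {x..<x + r})) \<le> exp (real n) / L + 2"
        using count[of "exp (real n)" 0] by simp
      also have "\<dots> \<le> C * 1"
        using \<rho> by (simp add: C_def)
      also have "\<dots> \<le> C * (r / exp (real n)) powr \<rho>"
        using False C \<rho> by (intro mult_left_mono ge_one_powr_ge_zero) auto
      finally show ?thesis .
    qed
  qed (use J u C in auto)
  then show ?thesis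
    by (simp add: C_def card_image[OF inj])
qed

text \<open>A box of side \<open>r \<ge> 1\<close> holds at most \<open>r + 1 \<le> 2 * r\<close>
  integers; this factor 2 is the only loss, so the bound does not depend on \<rho>.\<close>

lemma macro_content_ge_nat:
  fixes E :: "real set"
  assumes Q: "finite Q" "real ` Q \<subseteq> E \<inter> macro_shell n" and \<rho>: "0 < \<rho>" "\<rho> \<le> 1"
    and card: "real (card Q) \<le> exp (real n)"
  shows "ennreal (real (card Q) / (2 * exp (real n))) \<le> macro_content \<rho> n E"
proof -
  have inj: "inj_on real S" for S
    by (simp add: inj_on_def)
  have "ennreal (real (card (real ` Q)) / (2 * exp (real n))) \<le> macro_content \<rho> n E"
  proof (rule macro_content_ge)
    fix x r :: real assume r: "1 \<le> r"
    have "real ` Q \<inter> {x..<x + r} = real ` {k\<in>Q. real k \<in> {x..<x + r}}"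
      by auto
    then have count: "card (real ` Q \<inter> {x..<x + r}) = card {k\<in>Q. real k \<in> {x..<x + r}}"
      using card_image[OF inj] by simp
    show "real (card (real ` Q \<inter> {x..<x + r})) \<le> 2 * exp (real n) * (r / exp (real n)) powr \<rho>"
    proof (cases "r \<le> exp (real n)")
      case True
      have "real (card {k\<in>Q. real k \<in> {x..<x + r}}) \<le> r + 1"
        using Q r by (intro card_le_of_diff_le) auto
      also have "\<dots> \<le> 2 * exp (real n) * (r / exp (real n)) powr 1"
        using r by simp
      also have "\<dots> \<le> 2 * exp (real n) * (r / exp (real n)) powr \<rho>"
        using r True \<rho> by (intro mult_left_mono powr_mono') auto
      finally show ?thesis
        by (simp add: count)
    next
      case False
      have "real (card {k\<in>Q. real k \<in> {x..<x + r}}) \<le> real (card Q)"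
        using Q by (intro of_nat_mono card_mono) auto
      also have "\<dots> \<le> 2 * exp (real n) * 1"
        using card exp_gt_zero[of "real n"] by linarith
      also have "\<dots> \<le> 2 * exp (real n) * (r / exp (real n)) powr \<rho>"
        using False \<rho> by (intro mult_left_mono ge_one_powr_ge_zero) auto
      finally show ?thesis
        by (simp add: count)
    qed
  qed (use Q in auto)
  then show ?thesis
    by (simp add: card_image[OF inj])
qed

subsection \<open>Gaussian tails and divergent series\<close>

text \<open>On \<open>y \<ge> x \<ge> 0\<close> the density is at most the exponential factor times
  the normal density centred at \<open>x\<close>, because
  \<open>y\<^sup>2 - x\<^sup>2 - (y - x)\<^sup>2 = 2 * x * (y - x)\<close> is non-negative; the
  shifted density integrates to 1.\<close>

lemma (in prob_space) normal_tail_upper: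
  assumes X: "distributed M lborel X (normal_density 0 \<sigma>)" and \<sigma>: "0 < \<sigma>" and x: "0 \<le> x"
  shows "prob {\<omega>\<in>space M. x \<le> X \<omega>} \<le> exp (- x\<^sup>2 / (2 * \<sigma>\<^sup>2))"
proof -
  have le: "normal_density 0 \<sigma> y * indicator {x..} y \<le> exp (- x\<^sup>2 / (2 * \<sigma>\<^sup>2)) * normal_density x \<sigma> y" for y
  proof (cases "x \<le> y")
    case True
    have "x\<^sup>2 + (y - x)\<^sup>2 \<le> y\<^sup>2"
      using mult_nonneg_nonneg[OF x, of "y - x"] True by (simp add: power2_eq_square algebra_simps)
    then have "- y\<^sup>2 / (2 * \<sigma>\<^sup>2) \<le> - x\<^sup>2 / (2 * \<sigma>\<^sup>2) + - (y - x)\<^sup>2 / (2 * \<sigma>\<^sup>2)"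
      unfolding add_divide_distrib[symmetric] by (intro divide_right_mono) auto
    then have "exp (- y\<^sup>2 / (2 * \<sigma>\<^sup>2)) \<le> exp (- x\<^sup>2 / (2 * \<sigma>\<^sup>2)) * exp (- (y - x)\<^sup>2 / (2 * \<sigma>\<^sup>2))"
      unfolding exp_add[symmetric] by simp
    then show ?thesis
      using True \<sigma> by (simp add: normal_density_def field_simps)
  qed simp
  have "emeasure M {\<omega>\<in>space M. x \<le> X \<omega>} = emeasure M (X -` {x..} \<inter> space M)"
    by (intro arg_cong[where f="emeasure M"]) auto
  also have "\<dots> = (\<integral>\<^sup>+y. ennreal (normal_density 0 \<sigma> y) * indicator {x..} y \<partial>lborel)"
    using X by (rule distributed_emeasure) simp
  also have "\<dots> \<le> (\<integral>\<^sup>+y. ennreal (exp (- x\<^sup>2 / (2 * \<sigma>\<^sup>2))) * ennreal (normal_density x \<sigma> y) \<partial>lborel)"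
    using le by (intro nn_integral_mono)
      (auto simp: ennreal_mult[symmetric] ennreal_indicator[symmetric] intro!: ennreal_leI)
  also have "\<dots> = ennreal (exp (- x\<^sup>2 / (2 * \<sigma>\<^sup>2)))"
    using \<sigma> by (simp add: nn_integral_cmult nn_integral_eq_integral)
  finally show ?thesis
    by (simp add: emeasure_eq_measure)
qed

text \<open>Only an interval of length \<open>\<sigma> / z\<close> to the right of the threshold is
  kept. Up to its end the exponent falls to at most
  \<open>(z + 1 / z)\<^sup>2 / 2 \<le> z\<^sup>2 / 2 + 3 / 2\<close> in absolute value, and the
  length supplies the factor \<open>1 / z\<close>.\<close>

lemma (in prob_space) normal_tail_lower:
  assumes X: "distributed M lborel X (normal_density 0 \<sigma>)" and \<sigma>: "0 < \<sigma>" and z: "1 \<le> z"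
  shows "exp (- 3 / 2 - z\<^sup>2 / 2) / (z * sqrt (2 * pi)) \<le> prob {\<omega>\<in>space M. z * \<sigma> \<le> X \<omega>}"
proof -
  define c where "c = exp (- 3 / 2 - z\<^sup>2 / 2) / (\<sigma> * sqrt (2 * pi))"
  have c: "0 \<le> c"
    using \<sigma> by (simp add: c_def)
  let ?I = "{z * \<sigma>..z * \<sigma> + \<sigma> / z}"
  have le: "c * indicator ?I y \<le> normal_density 0 \<sigma> y * indicator {z * \<sigma>..} y" for y
  proof (cases "y \<in> ?I")
    case True
    then have y: "0 \<le> y / \<sigma>" "y / \<sigma> \<le> z + 1 / z"
      using z \<sigma> order.trans[of 0 "z * \<sigma>" y] by (auto simp: field_simps)
    have "(y / \<sigma>)\<^sup>2 \<le> (z + 1 / z)\<^sup>2"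
      using y by (intro power_mono)
    also have "\<dots> = z\<^sup>2 + 2 + (1 / z)\<^sup>2"
      using z by (simp add: power2_sum)
    also have "(1 / z)\<^sup>2 \<le> 1"
      using z by (simp add: power_le_one)
    finally have "exp (- 3 / 2 - z\<^sup>2 / 2) \<le> exp (- y\<^sup>2 / (2 * \<sigma>\<^sup>2))"
      by (simp add: power_divide field_simps)
    then have "c \<le> exp (- y\<^sup>2 / (2 * \<sigma>\<^sup>2)) / (\<sigma> * sqrt (2 * pi))"
      using \<sigma> unfolding c_def by (intro divide_right_mono) auto
    also have "\<dots> = normal_density 0 \<sigma> y"
      using \<sigma> by (simp add: normal_density_def real_sqrt_mult)
    finally show ?thesis
      using True by simp
  qed simp
  have "ennreal (exp (- 3 / 2 - z\<^sup>2 / 2) / (z * sqrt (2 * pi))) = ennreal (c * (\<sigma> / z))"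
    using \<sigma> z by (simp add: c_def)
  also have "\<dots> = (\<integral>\<^sup>+y. ennreal c * indicator ?I y \<partial>lborel)"
    using c \<sigma> z by (simp add: nn_integral_cmult ennreal_mult[symmetric])
  also have "\<dots> \<le> (\<integral>\<^sup>+y. ennreal (normal_density 0 \<sigma> y) * indicator {z * \<sigma>..} y \<partial>lborel)"
    using le c by (intro nn_integral_mono)
      (auto simp: ennreal_mult[symmetric] ennreal_indicator[symmetric] intro!: ennreal_leI)
  also have "\<dots> = emeasure M (X -` {z * \<sigma>..} \<inter> space M)"
    using X by (rule distributed_emeasure[symmetric]) simp
  also have "\<dots> = emeasure M {\<omega>\<in>space M. z * \<sigma> \<le> X \<omega>}"
    by (intro arg_cong[where f="emeasure M"]) auto
  finally show ?thesis
    by (simp add: emeasure_eq_measure)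
qed

lemma (in prob_space) normal_uminus:
  assumes "distributed M lborel X (normal_density 0 \<sigma>)" "0 < \<sigma>"
  shows "distributed M lborel (\<lambda>\<omega>. - X \<omega>) (normal_density 0 \<sigma>)"
  using normal_density_affine[OF assms, of "-1" 0] by simp

text \<open>\<open>X\<close> and \<open>- X\<close> have the same law, and one of them is
  non-negative at every point.\<close>

lemma (in prob_space) normal_nonneg_prob:
  assumes X: "distributed M lborel X (normal_density 0 \<sigma>)" and \<sigma>: "0 < \<sigma>"
  shows "1 / 2 \<le> prob {\<omega>\<in>space M. 0 \<le> X \<omega>}"
proof -
  have rv [measurable]: "random_variable borel X"
    using X by (auto dest: distributed_measurable)
  have eq: "prob {\<omega>\<in>space M. 0 \<le> - X \<omega>} = prob {\<omega>\<in>space M. 0 \<le> X \<omega>}"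
  proof -
    have "emeasure M (X -` {0..} \<inter> space M) = emeasure M ((\<lambda>\<omega>. - X \<omega>) -` {0..} \<inter> space M)"
      by (simp only: distributed_emeasure[OF X] distributed_emeasure[OF normal_uminus[OF X \<sigma>]] sets_lborel borel_closed closed_atLeast)
    then show ?thesis
      by (simp add: emeasure_eq_measure vimage_def Int_def conj_commute)
  qed
  have "1 = prob ({\<omega>\<in>space M. 0 \<le> - X \<omega>} \<union> {\<omega>\<in>space M. 0 \<le> X \<omega>})"
    using prob_space by (intro trans[OF prob_space[symmetric]] arg_cong[where f=prob]) auto
  also have "\<dots> \<le> prob {\<omega>\<in>space M. 0 \<le> - X \<omega>} + prob {\<omega>\<in>space M. 0 \<le> X \<omega>}"
    by (intro measure_subadditive) auto
  finally show ?thesis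
    using eq by simp
qed

text \<open>Windows of length \<open>1 / m\<close> in logarithmic time cost a factor
  \<open>exp (- 2 / m)\<close> in the tail exponent; a fine mesh makes this loss harmless.\<close>

lemma exp_neg_divide_approx:
  assumes "(c::real) < g"
  obtains m :: nat where "0 < m" "c < g * exp (- 2 / real m)"
proof -
  have "(\<lambda>m. g * exp (- 2 * (1 / real m))) \<longlonglongrightarrow> g * exp (- 2 * 0)"
    by (intro tendsto_intros lim_1_over_n)
  then have "eventually (\<lambda>m. c < g * exp (- 2 * (1 / real m))) sequentially"
    using assms by (intro order_tendstoD) auto
  then have "eventually (\<lambda>m. 0 < m \<and> c < g * exp (- 2 * (1 / real m))) sequentially"
    by (intro eventually_conj eventually_gt_at_top)
  then show thesis
    using that by (auto dest!: eventually_happens)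
qed

section \<open>Divergence along subsequences and for independent bounded variables\<close>

lemma suminf_ennreal_eq_top_of_subseq:
  fixes f :: "nat \<Rightarrow> ennreal" and y :: "nat \<Rightarrow> real"
  assumes \<sigma>: "inj \<sigma>" and y: "\<And>j. 0 \<le> y j" "\<not> summable y"
    and le: "eventually (\<lambda>j. ennreal (y j) \<le> f (\<sigma> j)) sequentially"
  shows "(\<Sum>n. f n) = \<infinity>"
proof (rule ccontr)
  assume "(\<Sum>n. f n) \<noteq> \<infinity>"
  then obtain r where r: "0 \<le> r" "(\<Sum>n. f n) = ennreal r"
    by (cases "\<Sum>n. f n") auto
  obtain N where N: "\<And>j. N \<le> j \<Longrightarrow> ennreal (y j) \<le> f (\<sigma> j)"
    using le by (auto simp: eventually_sequentially)
  have "summable (\<lambda>j. y (j + N))"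
  proof (rule summableI_nonneg_bounded)
    fix k
    have "ennreal (\<Sum>j<k. y (j + N)) = (\<Sum>j<k. ennreal (y (j + N)))"
      using y by (simp add: sum_ennreal)
    also have "\<dots> \<le> (\<Sum>j<k. f (\<sigma> (j + N)))"
      using N by (intro sum_mono) auto
    also have "\<dots> = sum f ((\<lambda>j. \<sigma> (j + N)) ` {..<k})"
    proof -
      have "inj_on (\<lambda>j. \<sigma> (j + N)) {..<k}"
        using injD[OF \<sigma>] by (intro inj_onI) fastforce
      then show ?thesis
        by (simp add: sum.reindex comp_def)
    qed
    also have "\<dots> \<le> (\<Sum>n. f n)"
      by (intro sum_le_suminf) auto
    finally show "(\<Sum>j<k. y (j + N)) \<le> r"
      using r by simp
  qed (use y in auto)
  then show False
    using y(2) by (simp add: summable_iff_shift)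
qed

text \<open>A second Borel-Cantelli lemma for variables in \<open>[0, 1]\<close>, proved by Laplace
  transforms: by independence the expectation of \<open>exp (- (\<Sum>j<n. Y j))\<close> factorises
  and tends to 0, whereas the exponential of minus a convergent sum is positive.\<close>

lemma (in prob_space) indep_bounded_not_summable:
  fixes Y :: "nat \<Rightarrow> 'a \<Rightarrow> real"
  assumes indep: "\<And>n. indep_vars (\<lambda>_. borel) Y {..<n}"
    and Y: "\<And>j \<omega>. 0 \<le> Y j \<omega>" "\<And>j \<omega>. Y j \<omega> \<le> 1"
    and E: "\<not> summable (\<lambda>j. expectation (Y j))"
  shows "AE \<omega> in M. \<not> summable (\<lambda>j. Y j \<omega>)"
proof -
  have [measurable]: "Y j \<in> borel_measurable M" for j
    using indep[of "Suc j"] by (auto simp: indep_vars_def)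
  have int_Y: "integrable M (Y j)" for j
    using Y by (intro integrable_const_bound[where B=1]) auto
  have int_exp: "integrable M (\<lambda>\<omega>. exp (- Y j \<omega>))" for j
    using Y by (intro integrable_const_bound[where B=1]) auto
  have exp_le: "expectation (\<lambda>\<omega>. exp (- Y j \<omega>)) \<le> exp (- (expectation (Y j) / 2))" for j
  proof -
    \<comment> \<open>The second estimate below amounts to \<open>y\<^sup>2 \<le> y\<close>; this is
      where the bound \<open>Y j \<le> 1\<close> enters.\<close>
    have "exp (- y) \<le> 1 - y / 2" if "0 \<le> y" "y \<le> 1" for y :: real
    proof -
      have "exp (- y) \<le> 1 / (1 + y)"
        using exp_ge_add_one_self[of y] that by (simp add: exp_minus inverse_eq_divide frac_le)
      also have "\<dots> \<le> 1 - y / 2"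
        using that mult_left_le[of y y] by (simp add: field_simps)
      finally show ?thesis .
    qed
    then have "expectation (\<lambda>\<omega>. exp (- Y j \<omega>)) \<le> expectation (\<lambda>\<omega>. 1 - Y j \<omega> / 2)"
      using Y int_Y int_exp by (intro integral_mono) auto
    also have "\<dots> = 1 - expectation (Y j) / 2"
      using int_Y by (simp add: prob_space)
    also have "\<dots> \<le> exp (- (expectation (Y j) / 2))"
      using exp_ge_add_one_self[of "- (expectation (Y j) / 2)"] by simp
    finally show ?thesis .
  qed
  define Z where "Z n \<omega> = exp (- (\<Sum>j<n. Y j \<omega>))" for n \<omega>
  have [measurable]: "Z n \<in> borel_measurable M" for n
    unfolding Z_def by measurable
  have Z: "(\<integral>\<^sup>+\<omega>. ennreal (Z n \<omega>) \<partial>M) \<le> ennreal (exp (- ((\<Sum>j<n. expectation (Y j)) / 2)))" for n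
  proof -
    have prod: "Z n \<omega> = (\<Prod>j<n. exp (- Y j \<omega>))" for \<omega>
      by (simp add: Z_def exp_sum[symmetric] sum_negf)
    have "indep_vars (\<lambda>_. borel) (\<lambda>j \<omega>. exp (- Y j \<omega>)) {..<n}"
      using indep_vars_compose2[OF indep[of n], of "\<lambda>_ y. exp (- y)" "\<lambda>_. borel"] by simp
    then have "integrable M (Z n)" "expectation (Z n) = (\<Prod>j<n. expectation (\<lambda>\<omega>. exp (- Y j \<omega>)))"
      unfolding prod[abs_def] using int_exp by (auto intro!: indep_vars_integrable indep_vars_lebesgue_integral)
    moreover have "(\<Prod>j<n. expectation (\<lambda>\<omega>. exp (- Y j \<omega>))) \<le> (\<Prod>j<n. exp (- (expectation (Y j) / 2)))"
      using exp_le by (intro prod_mono) (auto intro!: integral_nonneg_AE)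
    moreover have "(\<Prod>j<n. exp (- (expectation (Y j) / 2))) = exp (- ((\<Sum>j<n. expectation (Y j)) / 2))"
      by (simp add: exp_sum[symmetric] sum_negf sum_divide_distrib)
    moreover have "(\<integral>\<^sup>+\<omega>. ennreal (Z n \<omega>) \<partial>M) = ennreal (expectation (Z n))" if "integrable M (Z n)"
      using that by (rule nn_integral_eq_integral) (simp add: Z_def)
    ultimately show ?thesis
      by (simp add: ennreal_leI)
  qed
  \<comment> \<open>The infimum is positive wherever the series converges, so it suffices that its
    integral vanishes.\<close>
  define I where "I = (\<integral>\<^sup>+\<omega>. (INF n. ennreal (Z n \<omega>)) \<partial>M)"
  have I_le: "I \<le> ennreal (exp (- ((\<Sum>j<n. expectation (Y j)) / 2)))" for n
  proof -
    have "I \<le> (\<integral>\<^sup>+\<omega>. ennreal (Z n \<omega>) \<partial>M)"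
      unfolding I_def by (intro nn_integral_mono INF_lower) simp
    then show ?thesis
      using Z[of n] by (rule order.trans)
  qed
  have "I = 0"
  proof (rule ccontr)
    assume "I \<noteq> 0"
    moreover have "I \<noteq> \<infinity>"
      using I_le[of 0] by (auto simp: top_unique)
    ultimately obtain r where r: "I = ennreal r" "0 < r"
      by (cases I) (auto simp: less_le)
    have "summable (\<lambda>j. expectation (Y j))"
    proof (rule summableI_nonneg_bounded)
      fix n
      have "r \<le> exp (- ((\<Sum>j<n. expectation (Y j)) / 2))"
        using I_le[of n] r by simp
      then have "ln r \<le> - ((\<Sum>j<n. expectation (Y j)) / 2)"
        using r(2) by (metis ln_exp ln_le_cancel_iff exp_gt_zero)
      then show "(\<Sum>j<n. expectation (Y j)) \<le> - 2 * ln r"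
        by simp
    qed (use Y in \<open>auto intro!: integral_nonneg_AE\<close>)
    then show False
      using E by contradiction
  qed
  then have "AE \<omega> in M. (INF n. ennreal (Z n \<omega>)) = 0"
    unfolding I_def by (subst (asm) nn_integral_0_iff_AE) auto
  then show ?thesis
  proof eventually_elim
    case (elim \<omega>)
    show ?case
    proof
      assume summ: "summable (\<lambda>j. Y j \<omega>)"
      have "ennreal (exp (- (\<Sum>j. Y j \<omega>))) \<le> (INF n. ennreal (Z n \<omega>))"
        unfolding Z_def using Y summ by (intro INF_greatest ennreal_leI) (auto intro!: sum_le_suminf)
      then show False
        using elim by simp
    qed
  qed
qed

context standard_brownian_motion
begin

subsection \<open>The maximal inequality\<close>

lemma increment_measurable [measurable]:
  assumes "0 \<le> s" "0 \<le> t"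
  shows "(\<lambda>\<omega>. B t \<omega> - B s \<omega>) \<in> borel_measurable M"
  using measurable_B[OF assms(1)] measurable_B[OF assms(2)] by simp

lemma increment_tail_upper:
  assumes "0 \<le> s" "s < t" "0 \<le> x"
  shows "prob {\<omega>\<in>space M. x \<le> B t \<omega> - B s \<omega>} \<le> exp (- x\<^sup>2 / (2 * (t - s)))"
  using normal_tail_upper[OF normal_increments[OF assms(1,2)] _ assms(3)] assms(2) by simp

lemma increment_tail_upper_neg:
  assumes "0 \<le> s" "s < t" "0 \<le> x"
  shows "prob {\<omega>\<in>space M. B t \<omega> - B s \<omega> \<le> - x} \<le> exp (- x\<^sup>2 / (2 * (t - s)))"
  using normal_tail_upper[OF normal_uminus[OF normal_increments[OF assms(1,2)]] _ assms(3)] assms(2)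
  by (simp add: algebra_simps)

lemma increment_tail_lower:
  assumes "0 \<le> s" "s < t" "1 \<le> z"
  shows "exp (- 3 / 2 - z\<^sup>2 / 2) / (z * sqrt (2 * pi)) \<le> prob {\<omega>\<in>space M. z * sqrt (t - s) \<le> B t \<omega> - B s \<omega>}"
  using normal_tail_lower[OF normal_increments[OF assms(1,2)] _ assms(3)] assms(2) by simp

text \<open>Levy's inequality. Decompose by the first index \<open>k\<close> at which the level is
  reached: the remaining increment is independent of this event and non-negative with probability at
  least 1/2, and then the final value is still above the level.\<close>

lemma maximal_inequality_discrete:
  assumes \<tau>: "0 \<le> \<tau> 0" "\<And>i. i < n \<Longrightarrow> \<tau> i < \<tau> (Suc i)"
  shows "prob {\<omega>\<in>space M. \<exists>i\<le>n. x \<le> B (\<tau> i) \<omega> - B (\<tau> 0) \<omega>}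
    \<le> 2 * prob {\<omega>\<in>space M. x \<le> B (\<tau> n) \<omega> - B (\<tau> 0) \<omega>}"
proof -
  define S where "S i \<omega> = B (\<tau> i) \<omega> - B (\<tau> 0) \<omega>" for i \<omega>
  define D where "D i \<omega> = B (\<tau> (Suc i)) \<omega> - B (\<tau> i) \<omega>" for i \<omega>
  have \<tau>_mono: "\<tau> i \<le> \<tau> j" if "i \<le> j" "j \<le> n" for i j
    using that
  proof (induction j rule: dec_induct)
    case (step k)
    then show ?case
      using \<tau>(2)[of k] by simp
  qed simp
  have \<tau>_less: "\<tau> i < \<tau> n" if "i < n" for i
    using \<tau>(2)[OF that] \<tau>_mono[of "Suc i" n] that by simp
  have \<tau>_nonneg: "0 \<le> \<tau> i" if "i \<le> n" for i
    using \<tau>(1) \<tau>_mono[of 0 i] that by simp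
  have S_measurable: "S i \<in> borel_measurable M" if "i \<le> n" for i
    unfolding S_def using \<tau>_nonneg[OF that] \<tau>(1) by (intro increment_measurable)
  have indep: "indep_vars (\<lambda>_. borel) D {..<n}"
    unfolding D_def using \<tau> by (intro indep_increments) auto
  have S_eq: "S i \<omega> = (\<Sum>l<i. D l \<omega>)" for i \<omega>
    unfolding S_def D_def using sum_lessThan_telescope[of "\<lambda>i. B (\<tau> i) \<omega>" i] by simp
  define A where "A k = {\<omega>\<in>space M. x \<le> S k \<omega> \<and> (\<forall>i<k. S i \<omega> < x)}" for k
  define C where "C k = {\<omega>\<in>space M. 0 \<le> S n \<omega> - S k \<omega>}" for k
  have A_sets: "A k \<in> events" if "k \<le> n" for k
  proof -
    \<comment> \<open>Outside the range where \<open>S i\<close> is known to be measurable the dummy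
      value \<open>x - 1\<close> is inserted: it satisfies \<open>< x\<close>, so the condition may
      range over all \<open>i\<close>.\<close>
    have [measurable]: "(\<lambda>\<omega>. if i < k then S i \<omega> else x - 1) \<in> borel_measurable M" for i
      using S_measurable[of i] that by (cases "i < k") auto
    have "A k = {\<omega>\<in>space M. x \<le> S k \<omega> \<and> (\<forall>i. (if i < k then S i \<omega> else x - 1) < x)}"
      by (auto simp: A_def)
    also have "\<dots> \<in> events"
      using S_measurable[OF that] by measurable
    finally show ?thesis .
  qed
  have C_sets: "C k \<in> events" if "k \<le> n" for k
    unfolding C_def using S_measurable[OF that] S_measurable[of n] by measurable
  have AC: "prob (A k) \<le> 2 * prob (A k \<inter> C k)" if k: "k \<le> n" for k
  proof (cases "k = n")
    case True
    have "A n \<inter> C n = A n"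
      by (auto simp: A_def C_def)
    then show ?thesis
      using True by simp
  next
    case False
    with k have kn: "k < n" by simp
    \<comment> \<open>\<open>f\<close> and \<open>g\<close> express \<open>A k\<close> and
      \<open>C k\<close> through disjoint sets of increments, so that independence of the restricted
      families applies.\<close>
    define f where "f d = (x \<le> (\<Sum>l<k. d l) \<and> (\<forall>i<k. (\<Sum>l<i. d l) < x))" for d :: "nat \<Rightarrow> real"
    define g where "g d = (0 \<le> (\<Sum>l\<in>{k..<n}. d l))" for d :: "nat \<Rightarrow> real"
    let ?P = "PiM {..<k} (\<lambda>_. borel :: real measure)" and ?Q = "PiM {k..<n} (\<lambda>_. borel :: real measure)"
    have [measurable]: "(\<lambda>d. if i \<le> k then \<Sum>l<i. d l else x - 1) \<in> borel_measurable ?P" for i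
      by (cases "i \<le> k") auto
    have "f d \<longleftrightarrow> x \<le> (if k \<le> k then \<Sum>l<k. d l else x - 1) \<and>
        (\<forall>i. i < k \<longrightarrow> (if i \<le> k then \<Sum>l<i. d l else x - 1) < x)" for d
      by (auto simp: f_def)
    then have [measurable]: "Measurable.pred ?P f"
      by (subst measurable_cong) measurable
    have [measurable]: "Measurable.pred ?Q g"
      unfolding g_def by measurable
    have "indep_var ?P (\<lambda>\<omega>. restrict (\<lambda>i. D i \<omega>) {..<k}) ?Q (\<lambda>\<omega>. restrict (\<lambda>i. D i \<omega>) {k..<n})"
      using kn by (intro indep_var_restrict[OF indep]) auto
    then have "prob ((\<lambda>\<omega>. (restrict (\<lambda>i. D i \<omega>) {..<k}, restrict (\<lambda>i. D i \<omega>) {k..<n})) -`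
          ({d\<in>space ?P. f d} \<times> {d\<in>space ?Q. g d}) \<inter> space M) =
        prob ((\<lambda>\<omega>. restrict (\<lambda>i. D i \<omega>) {..<k}) -` {d\<in>space ?P. f d} \<inter> space M) *
        prob ((\<lambda>\<omega>. restrict (\<lambda>i. D i \<omega>) {k..<n}) -` {d\<in>space ?Q. g d} \<inter> space M)"
      by (rule indep_varD) measurable
    moreover have fA: "f (restrict (\<lambda>i. D i \<omega>) {..<k}) \<longleftrightarrow> x \<le> S k \<omega> \<and> (\<forall>i<k. S i \<omega> < x)" for \<omega>
      unfolding f_def S_eq by simp
    moreover have gC: "g (restrict (\<lambda>i. D i \<omega>) {k..<n}) \<longleftrightarrow> 0 \<le> S n \<omega> - S k \<omega>" for \<omega>
      unfolding g_def using sum_Suc_diff'[of k n "\<lambda>i. B (\<tau> i) \<omega>"] kn by (simp add: S_def D_def)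
    moreover have "(\<lambda>\<omega>. restrict (\<lambda>i. D i \<omega>) {..<k}) -` {d\<in>space ?P. f d} \<inter> space M = A k"
      by (auto simp: A_def fA space_PiM)
    moreover have "(\<lambda>\<omega>. restrict (\<lambda>i. D i \<omega>) {k..<n}) -` {d\<in>space ?Q. g d} \<inter> space M = C k"
      by (auto simp: C_def gC space_PiM)
    moreover have "(\<lambda>\<omega>. (restrict (\<lambda>i. D i \<omega>) {..<k}, restrict (\<lambda>i. D i \<omega>) {k..<n})) -`
          ({d\<in>space ?P. f d} \<times> {d\<in>space ?Q. g d}) \<inter> space M = A k \<inter> C k"
      by (auto simp: A_def C_def fA gC space_PiM)
    ultimately have "prob (A k \<inter> C k) = prob (A k) * prob (C k)"
      by simp
    moreover have "1 / 2 \<le> prob (C k)"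
    proof -
      have "C k = {\<omega>\<in>space M. 0 \<le> B (\<tau> n) \<omega> - B (\<tau> k) \<omega>}"
        by (auto simp: C_def S_def)
      then show ?thesis
        using normal_nonneg_prob[OF normal_increments[OF \<tau>_nonneg[OF k] \<tau>_less[OF kn]]] \<tau>_less[OF kn] by simp
    qed
    then have "prob (A k) * (1 / 2) \<le> prob (A k) * prob (C k)"
      by (intro mult_left_mono) auto
    ultimately show ?thesis
      by simp
  qed
  have disj: "disjoint_family_on A {..n}"
    unfolding disjoint_family_on_def
  proof (intro ballI impI)
    fix i j :: nat assume "i \<noteq> j"
    then consider "i < j" | "j < i"
      by linarith
    then show "A i \<inter> A j = {}"
      by cases (auto simp: A_def not_le[symmetric])
  qed
  have "{\<omega>\<in>space M. \<exists>i\<le>n. x \<le> S i \<omega>} = (\<Union>k\<le>n. A k)"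
  proof (intro equalityI subsetI)
    fix \<omega> assume "\<omega> \<in> {\<omega>\<in>space M. \<exists>i\<le>n. x \<le> S i \<omega>}"
    then obtain i where i: "\<omega> \<in> space M" "i \<le> n" "x \<le> S i \<omega>"
      by auto
    define k where "k = (LEAST i. x \<le> S i \<omega>)"
    have "x \<le> S k \<omega>" "k \<le> i" "\<And>l. l < k \<Longrightarrow> \<not> x \<le> S l \<omega>"
      unfolding k_def using i LeastI[of "\<lambda>i. x \<le> S i \<omega>" i] Least_le[of "\<lambda>i. x \<le> S i \<omega>" i] not_less_Least by auto
    with i show "\<omega> \<in> (\<Union>k\<le>n. A k)"
      by (intro UN_I[of k]) (auto simp: A_def not_le)
  qed (auto simp: A_def)
  then have "prob {\<omega>\<in>space M. \<exists>i\<le>n. x \<le> S i \<omega>} = (\<Sum>k\<le>n. prob (A k))"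
    using disj A_sets by (simp add: finite_measure_finite_Union image_subset_iff)
  also have "\<dots> \<le> (\<Sum>k\<le>n. 2 * prob (A k \<inter> C k))"
    using AC by (intro sum_mono) auto
  also have "\<dots> = 2 * prob (\<Union>k\<le>n. A k \<inter> C k)"
    using disj A_sets C_sets by (subst finite_measure_finite_Union)
      (auto simp: sum_distrib_left image_subset_iff disjoint_family_on_def)
  also have "\<dots> \<le> 2 * prob {\<omega>\<in>space M. x \<le> S n \<omega>}"
    using S_measurable[of n] by (intro mult_left_mono finite_measure_mono) (auto simp: A_def C_def)
  finally show ?thesis
    unfolding S_def .
qed

text \<open>The event concerning uncountably many times is replaced by a measurable
  \<open>G\<close>, the union over dyadic grids, which contains it up to a null set. The strict
  inequality \<open>x < B s\<close> survives at nearby grid points by continuity.\<close>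

lemma maximal_inequality:
  assumes T: "0 < T" and x: "0 < x"
  shows "\<exists>G\<in>events. prob G \<le> 2 * exp (- x\<^sup>2 / (2 * T)) \<and>
    (AE \<omega> in M. (\<exists>s\<in>{0..T}. x < B s \<omega>) \<longrightarrow> \<omega> \<in> G)"
proof -
  define \<tau> where "\<tau> m i = real i * T / 2 ^ m" for m i :: nat
  have \<tau>_nonneg: "0 \<le> \<tau> m i" for m i
    using T by (simp add: \<tau>_def)
  define A where "A m = {\<omega>\<in>space M. \<exists>i\<le>2 ^ m. x \<le> B (\<tau> m i) \<omega> - B (\<tau> m 0) \<omega>}" for m
  have meas [measurable]: "(\<lambda>\<omega>. B (\<tau> m i) \<omega> - B (\<tau> m 0) \<omega>) \<in> borel_measurable M" for m i
    using \<tau>_nonneg by (intro increment_measurable)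
  have A_sets [measurable]: "A m \<in> events" for m
    unfolding A_def by measurable
  have "prob (A m) \<le> 2 * exp (- x\<^sup>2 / (2 * T))" for m
  proof -
    have "prob (A m) \<le> 2 * prob {\<omega>\<in>space M. x \<le> B (\<tau> m (2 ^ m)) \<omega> - B (\<tau> m 0) \<omega>}"
      unfolding A_def using T x
      by (intro maximal_inequality_discrete) (auto simp: \<tau>_def field_simps)
    also have "\<dots> \<le> 2 * exp (- x\<^sup>2 / (2 * T))"
      using increment_tail_upper[of 0 T x] T x by (simp add: \<tau>_def)
    finally show ?thesis .
  qed
  moreover have "(\<lambda>m. prob (A m)) \<longlonglongrightarrow> prob (\<Union>m. A m)"
  proof (intro finite_Lim_measure_incseq incseq_SucI)
    fix m show "A m \<subseteq> A (Suc m)"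
    proof
      fix \<omega> assume "\<omega> \<in> A m"
      then obtain i where "\<omega> \<in> space M" "i \<le> 2 ^ m" "x \<le> B (\<tau> m i) \<omega> - B (\<tau> m 0) \<omega>"
        by (auto simp: A_def)
      moreover have "\<tau> m i = \<tau> (Suc m) (2 * i)" "\<tau> m 0 = \<tau> (Suc m) 0"
        by (auto simp: \<tau>_def)
      ultimately show "\<omega> \<in> A (Suc m)"
        by (auto simp: A_def intro!: exI[of _ "2 * i"])
    qed
  qed auto
  ultimately have "prob (\<Union>m. A m) \<le> 2 * exp (- x\<^sup>2 / (2 * T))"
    by (intro LIMSEQ_le_const2) auto
  moreover have "AE \<omega> in M. (\<exists>s\<in>{0..T}. x < B s \<omega>) \<longrightarrow> \<omega> \<in> (\<Union>m. A m)"
    using start_zero continuous_paths AE_space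
  proof eventually_elim
    case (elim \<omega>)
    show ?case
    proof
      assume "\<exists>s\<in>{0..T}. x < B s \<omega>"
      then obtain s where s: "0 \<le> s" "s \<le> T" "x < B s \<omega>"
        by auto
      \<comment> \<open>The grid points just left of \<open>s\<close> stay inside
        \<open>{0..T}\<close> and converge to \<open>s\<close>.\<close>
      define k where "k m = nat \<lfloor>s * 2 ^ m / T\<rfloor>" for m
      have k: "real (k m) \<le> s * 2 ^ m / T" "s * 2 ^ m / T < real (k m) + 1" for m
        using s T unfolding k_def by (auto simp: of_nat_nat intro!: divide_nonneg_pos)
      have lim: "(\<lambda>m. \<tau> m (k m)) \<longlonglongrightarrow> s"
      proof (rule tendsto_sandwich)
        have "(\<lambda>m. s - T * (1 / 2) ^ m) \<longlonglongrightarrow> s - T * 0"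
          by (intro tendsto_intros LIMSEQ_realpow_zero) auto
        then show "(\<lambda>m. s - T * (1 / 2) ^ m) \<longlonglongrightarrow> s"
          by simp
        show "eventually (\<lambda>m. s - T * (1 / 2) ^ m \<le> \<tau> m (k m)) sequentially"
        proof (intro always_eventually allI)
          fix m
          have "s * 2 ^ m / T * (T / 2 ^ m) \<le> (real (k m) + 1) * (T / 2 ^ m)"
            using k(2)[of m] T by (intro mult_right_mono) auto
          then show "s - T * (1 / 2) ^ m \<le> \<tau> m (k m)"
            using T by (simp add: \<tau>_def power_one_over algebra_simps add_divide_distrib)
        qed
        show "eventually (\<lambda>m. \<tau> m (k m) \<le> s) sequentially"
          using k(1) T by (intro always_eventually allI) (simp add: \<tau>_def field_simps)
      qed simp
      have "(\<lambda>m. B (\<tau> m (k m)) \<omega>) \<longlonglongrightarrow> B s \<omega>"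
        using continuous_on_tendsto_compose[OF elim(2) lim] s \<tau>_nonneg by simp
      then have "eventually (\<lambda>m. x < B (\<tau> m (k m)) \<omega>) sequentially"
        using s(3) by (rule order_tendstoD)
      then obtain m where m: "x < B (\<tau> m (k m)) \<omega>"
        by (auto dest: eventually_happens)
      have "real (k m) \<le> 2 ^ m"
        using k(1)[of m] s T by (elim order.trans) (simp add: field_simps)
      then have "k m \<le> 2 ^ m"
        by (metis of_nat_le_iff of_nat_numeral of_nat_power)
      moreover have "\<tau> m 0 = 0"
        by (simp add: \<tau>_def)
      ultimately have "\<omega> \<in> A m"
        using m elim by (auto simp: A_def intro!: exI[of _ "k m"])
      then show "\<omega> \<in> (\<Union>m. A m)"
        by blast
    qed
  qed
  ultimately show ?thesis
    by (intro bexI[of _ "\<Union>m. A m"]) auto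
qed

text \<open>Peaks of \<^term>\<open>B\<close> are located on the logarithmic time scale, where \<open>u \<mapsto> B (exp u)\<close>
  is cut into windows of length \<open>1 / m\<close>.\<close>

lemma peak_events:
  assumes \<gamma>: "0 < \<gamma>" and m: "0 < (m::nat)"
  shows "\<exists>G. (\<forall>i. G i \<in> events) \<and>
    (\<forall>i. 1 < real i / real m \<longrightarrow> prob (G i) \<le> 2 * (real i / real m) powr (- (\<gamma>\<^sup>2 * exp (- 2 / real m)))) \<and>
    (AE \<omega> in M. \<forall>u\<ge>exp 1. \<gamma> * sqrt (2 * exp u * ln u) \<le> B (exp u) \<omega> \<longrightarrow> \<omega> \<in> G (nat \<lfloor>u * real m\<rfloor>))"
proof -
  define v where "v i = real i / real m" for i
  define T where "T i = exp (v i + 1 / real m)" for i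
  \<comment> \<open>The factor \<open>exp (- 1 / (2 * m))\<close> makes a peak exceed the level
    strictly. Squared, it costs \<open>exp (- 1 / m)\<close>, and ending the window at
    \<open>T i\<close> costs the same again; together they give the exponent
    \<open>\<gamma>\<^sup>2 * exp (- 2 / m)\<close>.\<close>
  define x where "x i = \<gamma> * exp (- 1 / (2 * real m)) * sqrt (2 * exp (v i) * ln (v i))" for i
  have "\<exists>G. G \<in> events \<and> (1 < v i \<longrightarrow> prob G \<le> 2 * v i powr (- (\<gamma>\<^sup>2 * exp (- 2 / real m))) \<and>
      (AE \<omega> in M. (\<exists>s\<in>{0..T i}. x i < B s \<omega>) \<longrightarrow> \<omega> \<in> G))" for i
  proof (cases "1 < v i")
    case True
    then have "0 < x i" "0 < T i"
      using \<gamma> by (auto simp: x_def T_def)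
    moreover have "- (x i)\<^sup>2 / (2 * T i) = - (\<gamma>\<^sup>2 * exp (- 2 / real m)) * ln (v i)"
    proof -
      have "(x i)\<^sup>2 = \<gamma>\<^sup>2 * exp (- 1 / (2 * real m)) ^ 2 * (2 * exp (v i) * ln (v i))"
        using True by (simp add: x_def power_mult_distrib)
      also have "exp (- 1 / (2 * real m)) ^ 2 = exp (- 2 / real m) * exp (1 / real m)"
        unfolding exp_of_nat_mult[symmetric] exp_add[symmetric] using m by (simp add: field_simps)
      finally show ?thesis
        by (simp add: T_def exp_add field_simps)
    qed
    ultimately show ?thesis
      using maximal_inequality[of "T i" "x i"] True by (simp add: powr_def Bex_def)
  qed auto
  then have "\<exists>G. \<forall>i. G i \<in> events \<and> (1 < v i \<longrightarrow> prob (G i) \<le> 2 * v i powr (- (\<gamma>\<^sup>2 * exp (- 2 / real m))) \<and>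
      (AE \<omega> in M. (\<exists>s\<in>{0..T i}. x i < B s \<omega>) \<longrightarrow> \<omega> \<in> G i))"
    by (intro choice allI)
  then obtain G where G: "\<And>i. G i \<in> events"
    "\<And>i. 1 < v i \<Longrightarrow> prob (G i) \<le> 2 * v i powr (- (\<gamma>\<^sup>2 * exp (- 2 / real m)))"
    "\<And>i. 1 < v i \<Longrightarrow> AE \<omega> in M. (\<exists>s\<in>{0..T i}. x i < B s \<omega>) \<longrightarrow> \<omega> \<in> G i"
    by blast
  have "AE \<omega> in M. \<forall>i. 1 < v i \<longrightarrow> (\<exists>s\<in>{0..T i}. x i < B s \<omega>) \<longrightarrow> \<omega> \<in> G i"
    using G(3) by (auto simp: AE_all_countable intro: AE_impI)
  then have "AE \<omega> in M. \<forall>u\<ge>exp 1. \<gamma> * sqrt (2 * exp u * ln u) \<le> B (exp u) \<omega> \<longrightarrow> \<omega> \<in> G (nat \<lfloor>u * real m\<rfloor>)"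
  proof (eventually_elim, intro allI impI)
    fix \<omega> u
    assume *: "\<forall>i. 1 < v i \<longrightarrow> (\<exists>s\<in>{0..T i}. x i < B s \<omega>) \<longrightarrow> \<omega> \<in> G i"
      and u: "exp 1 \<le> u" and peak: "\<gamma> * sqrt (2 * exp u * ln u) \<le> B (exp u) \<omega>"
    define i where "i = nat \<lfloor>u * real m\<rfloor>"
    \<comment> \<open>Since a window has length at most 1, \<open>u \<ge> 2\<close> keeps its left
      end above 1, where \<open>ln (v i)\<close> is positive.\<close>
    have u2: "2 \<le> u"
      using u exp_ge_add_one_self[of 1] by simp
    have "real i \<le> u * real m" "u * real m < real i + 1"
      using u2 m by (auto simp: i_def)
    then have v: "v i \<le> u" "u < v i + 1 / real m"
      using m by (auto simp: v_def field_simps)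
    have "1 / real m \<le> 1"
      using m by simp
    then have v1: "1 < v i"
      using v u2 by linarith
    have "x i < \<gamma> * 1 * sqrt (2 * exp (v i) * ln (v i))"
      unfolding x_def using \<gamma> v1 m by (intro mult_strict_right_mono mult_strict_left_mono) auto
    also have "\<dots> \<le> \<gamma> * sqrt (2 * exp u * ln u)"
      using \<gamma> v v1 by (auto intro!: mult_left_mono mult_mono)
    finally have "x i < B (exp u) \<omega>"
      using peak by simp
    moreover have "exp u \<in> {0..T i}"
      using v by (auto simp: T_def)
    ultimately show "\<omega> \<in> G (nat \<lfloor>u * real m\<rfloor>)"
      using * v1 unfolding i_def by blast
  qed
  then show ?thesis
    using G unfolding v_def by blast
qed

text \<open>Upper half of the law of the iterated logarithm: the window probabilities decay like a
  power of exponent above 1, so Borel-Cantelli applies. In logarithmic time one statement serves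
  both processes, with \<open>u = ln s\<close> for \<open>B\<close> and with the time itself for
  \<open>U\<close>.\<close>

lemma lil_upper:
  assumes \<gamma>: "1 < \<gamma>"
  shows "AE \<omega> in M. \<exists>v. \<forall>u\<ge>v. B (exp u) \<omega> < \<gamma> * sqrt (2 * exp u * ln u)"
proof -
  have "1 < \<gamma>\<^sup>2"
    using \<gamma> by (simp add: one_less_power)
  then obtain m :: nat where m: "0 < m" "1 < \<gamma>\<^sup>2 * exp (- 2 / real m)"
    by (rule exp_neg_divide_approx)
  define c where "c = \<gamma>\<^sup>2 * exp (- 2 / real m)"
  obtain G where G: "\<And>i. G i \<in> events"
    "\<And>i. 1 < real i / real m \<Longrightarrow> prob (G i) \<le> 2 * (real i / real m) powr (- c)"
    "AE \<omega> in M. \<forall>u\<ge>exp 1. \<gamma> * sqrt (2 * exp u * ln u) \<le> B (exp u) \<omega> \<longrightarrow> \<omega> \<in> G (nat \<lfloor>u * real m\<rfloor>)"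
    using peak_events[of \<gamma>, OF _ m(1), folded c_def] \<gamma> by force
  have "summable (\<lambda>i. prob (G i))"
  proof (rule summable_comparison_test_ev)
    show "summable (\<lambda>i. 2 * (real i powr (- c) / real m powr (- c)))"
      using m by (intro summable_mult summable_divide) (simp add: summable_real_powr_iff c_def)
    show "eventually (\<lambda>i. norm (prob (G i)) \<le> 2 * (real i powr (- c) / real m powr (- c))) sequentially"
      using eventually_gt_at_top[of m]
    proof eventually_elim
      case (elim i)
      then show ?case
        using G(2)[of i] m by (simp add: powr_divide)
    qed
  qed
  then have "AE \<omega> in M. eventually (\<lambda>i. \<omega> \<in> space M - G i) sequentially"
    using G(1) by (intro borel_cantelli_AE1) (auto simp: emeasure_eq_measure)
  then show ?thesis
    using G(3)
  proof eventually_elim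
    case (elim \<omega>)
    then obtain N where N: "\<And>i. N \<le> i \<Longrightarrow> \<omega> \<notin> G i"
      by (auto simp: eventually_sequentially)
    have "B (exp u) \<omega> < \<gamma> * sqrt (2 * exp u * ln u)" if u: "max (exp 1) (real N / real m) \<le> u" for u
    proof -
      have "real N \<le> u * real m"
        using u m by (simp add: field_simps)
      then have "N \<le> nat \<lfloor>u * real m\<rfloor>"
        by (simp add: le_nat_floor)
      then show ?thesis
        using elim(2) N u by (meson max.boundedE not_le)
    qed
    then show ?case
      by blast
  qed
qed

subsection \<open>Peaks of the Ornstein-Uhlenbeck process\<close>

text \<open>In both peak sets the denominators are cleared and \<open>U\<close> is written through
  \<open>B\<close>, so that they compare the path with the same boundary, at times \<open>s\<close>
  and \<open>exp u\<close>.\<close>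

definition peaks :: "real \<Rightarrow> 'a \<Rightarrow> real set" where
  "peaks \<gamma> \<omega> = {s. exp (exp 1) \<le> s \<and> \<gamma> * sqrt (2 * s * ln (ln s)) \<le> B s \<omega>}"

definition OU_peaks :: "real \<Rightarrow> 'a \<Rightarrow> real set" where
  "OU_peaks \<gamma> \<omega> = {u. exp (exp 1) \<le> u \<and> \<gamma> * sqrt (2 * exp u * ln u) \<le> B (exp u) \<omega>}"

lemma bounded_peaks:
  assumes "1 < \<gamma>"
  shows "AE \<omega> in M. bounded (peaks \<gamma> \<omega>) \<and> bounded (OU_peaks \<gamma> \<omega>)"
  using lil_upper[OF assms]
proof eventually_elim
  case (elim \<omega>)
  then obtain v where v: "\<And>u. v \<le> u \<Longrightarrow> B (exp u) \<omega> < \<gamma> * sqrt (2 * exp u * ln u)"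
    by blast
  have "OU_peaks \<gamma> \<omega> \<subseteq> {exp (exp 1)..v}"
  proof
    fix u assume "u \<in> OU_peaks \<gamma> \<omega>"
    then show "u \<in> {exp (exp 1)..v}"
      using v[of u] by (cases "v \<le> u") (auto simp: OU_peaks_def)
  qed
  moreover have "peaks \<gamma> \<omega> \<subseteq> {exp (exp 1)..exp v}"
  proof
    fix s assume s: "s \<in> peaks \<gamma> \<omega>"
    then have "0 < s"
      unfolding peaks_def using exp_gt_zero[of "exp 1"] by (auto simp del: exp_gt_zero)
    then show "s \<in> {exp (exp 1)..exp v}"
      using s v[of "ln s"] ln_ge_iff[of s v] by (cases "v \<le> ln s") (auto simp: peaks_def)
  qed
  ultimately show ?case
    using bounded_subset bounded_closed_interval by blast
qed

section \<open>First moment bound: upper estimate for the Ornstein-Uhlenbeck dimension\<close>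

lemma OU_peaks_content_summable:
  assumes \<gamma>: "0 < \<gamma>" and \<rho>: "1 - \<gamma>\<^sup>2 < \<rho>"
  shows "AE \<omega> in M. (\<Sum>n. macro_content \<rho> (Suc n) (OU_peaks \<gamma> \<omega>)) < \<infinity>"
proof -
  have "1 - \<rho> < \<gamma>\<^sup>2"
    using \<rho> by simp
  then obtain m :: nat where m: "0 < m" "1 - \<rho> < \<gamma>\<^sup>2 * exp (- 2 / real m)"
    by (rule exp_neg_divide_approx)
  define c where "c = \<gamma>\<^sup>2 * exp (- 2 / real m)"
  have c: "0 \<le> c" "1 - \<rho> - c < 0"
    using m by (auto simp: c_def)
  obtain G where G: "\<And>i. G i \<in> events"
    "\<And>i. 1 < real i / real m \<Longrightarrow> prob (G i) \<le> 2 * (real i / real m) powr (- c)"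
    "AE \<omega> in M. \<forall>u\<ge>exp 1. \<gamma> * sqrt (2 * exp u * ln u) \<le> B (exp u) \<omega> \<longrightarrow> \<omega> \<in> G (nat \<lfloor>u * real m\<rfloor>)"
    using peak_events[OF \<gamma> m(1), folded c_def] by blast
  note G(1)[measurable]
  \<comment> \<open>Windows that may meet \<open>[exp n, exp (n + 1))\<close>; the
    \<open>- 1\<close> admits the one that contains \<open>exp n\<close> but starts before
    it.\<close>
  define I where "I n = {i. i < nat \<lceil>real m * exp (real (Suc n))\<rceil> \<and> real m * exp (real n) - 1 \<le> real i}" for n
  have fin: "finite (I n)" for n
    unfolding I_def by simp
  define F where "F n \<omega> = ennreal (exp (- real (Suc n) * \<rho>)) * (\<Sum>i\<in>I n. indicator (G i) \<omega>)" for n \<omega>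
  have F_meas [measurable]: "F n \<in> borel_measurable M" for n
    unfolding F_def by measurable
  \<comment> \<open>Writing \<open>n - 1\<close> for \<open>n\<close> absorbs this overhang, since
    \<open>exp (n - 1) \<le> exp n - 1 / m\<close> for \<open>n \<ge> 2\<close>. For smaller
    \<open>n\<close> the claimed bound is at least 2.\<close>
  have prob_G: "prob (G i) \<le> 2 * exp (- (real n - 1) * c)" if "i \<in> I n" for n i
  proof (cases "2 \<le> n")
    case True
    have e: "exp (real n - 1) \<le> real i / real m"
    proof -
      have "2 * exp (real n - 1) \<le> exp 1 * exp (real n - 1)"
        using exp_ge_add_one_self[of 1] by (intro mult_right_mono) auto
      also have "\<dots> = exp (real n)"
        by (simp add: exp_add[symmetric])
      finally have "2 * exp (real n - 1) \<le> exp (real n)" .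
      moreover have "1 \<le> exp (real n - 1)"
        using True by simp
      ultimately have "exp (real n - 1) \<le> exp (real n) - 1"
        by linarith
      also have "\<dots> \<le> exp (real n) - 1 / real m"
        using m by (simp add: field_simps)
      also have "\<dots> \<le> real i / real m"
      proof -
        have "real m * exp (real n) - 1 \<le> real i"
          using that by (simp add: I_def)
        then have "(real m * exp (real n) - 1) / real m \<le> real i / real m"
          by (intro divide_right_mono) auto
        then show ?thesis
          using m by (simp add: diff_divide_distrib)
      qed
      finally show ?thesis .
    qed
    have "1 < exp (real n - 1)"
      using True by simp
    with e have "1 < real i / real m"
      by linarith
    then have "prob (G i) \<le> 2 * (real i / real m) powr (- c)"
      by (rule G(2))
    also have "\<dots> \<le> 2 * exp (real n - 1) powr (- c)"
      using e c by (intro mult_left_mono powr_mono2') auto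
    finally show ?thesis
      by (simp add: powr_def algebra_simps)
  next
    case False
    then have "0 \<le> - (real n - 1) * c"
      using c by (intro mult_nonneg_nonneg) auto
    then have "1 \<le> exp (- (real n - 1) * c)"
      by (simp only: one_le_exp_iff)
    then show ?thesis
      using prob_le_1[of "G i"] by linarith
  qed
  define K where "K = 2 * (real m * exp 1 + 1) * exp (c - \<rho>)"
  \<comment> \<open>Per step of \<open>n\<close>: a factor \<open>exp 1\<close> in the number of
    windows, \<open>exp (- c)\<close> in their probability and \<open>exp (- \<rho>)\<close> in the
    cost of a box.\<close>
  define q where "q = exp (1 - \<rho> - c)"
  have int_F: "(\<integral>\<^sup>+\<omega>. F n \<omega> \<partial>M) \<le> ennreal (K * q ^ n)" for n
  proof -
    have "real (card (I n)) \<le> real (card {..<nat \<lceil>real m * exp (real (Suc n))\<rceil>})"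
      unfolding of_nat_le_iff by (intro card_mono) (auto simp: I_def)
    also have "\<dots> \<le> real m * exp (real (Suc n)) + 1"
      using m by (simp add: of_nat_nat)
    also have "\<dots> \<le> (real m * exp 1 + 1) * exp (real n)"
      by (simp add: exp_add algebra_simps)
    finally have card: "real (card (I n)) \<le> (real m * exp 1 + 1) * exp (real n)" .
    have "(\<integral>\<^sup>+\<omega>. F n \<omega> \<partial>M) = ennreal (exp (- real (Suc n) * \<rho>)) * (\<Sum>i\<in>I n. emeasure M (G i))"
      unfolding F_def by (simp add: nn_integral_cmult nn_integral_sum)
    also have "\<dots> = ennreal (exp (- real (Suc n) * \<rho>) * (\<Sum>i\<in>I n. prob (G i)))"
      by (simp add: emeasure_eq_measure ennreal_mult sum_nonneg)
    also have "\<dots> \<le> ennreal (exp (- real (Suc n) * \<rho>) * (((real m * exp 1 + 1) * exp (real n)) * (2 * exp (- (real n - 1) * c))))"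
    proof (intro ennreal_leI mult_left_mono)
      have "(\<Sum>i\<in>I n. prob (G i)) \<le> real (card (I n)) * (2 * exp (- (real n - 1) * c))"
        using prob_G by (intro sum_bounded_above) auto
      also have "\<dots> \<le> ((real m * exp 1 + 1) * exp (real n)) * (2 * exp (- (real n - 1) * c))"
        using card by (intro mult_right_mono) auto
      finally show "(\<Sum>i\<in>I n. prob (G i)) \<le> \<dots>" .
    qed simp
    also have "exp (- real (Suc n) * \<rho>) * (((real m * exp 1 + 1) * exp (real n)) * (2 * exp (- (real n - 1) * c))) =
        2 * (real m * exp 1 + 1) * exp (- real (Suc n) * \<rho> + (real n + - (real n - 1) * c))"
      unfolding exp_add by (simp only: mult_ac)
    also have "- real (Suc n) * \<rho> + (real n + - (real n - 1) * c) = (c - \<rho>) + real n * (1 - \<rho> - c)"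
      by (simp add: algebra_simps)
    also have "2 * (real m * exp 1 + 1) * exp ((c - \<rho>) + real n * (1 - \<rho> - c)) = K * q ^ n"
      unfolding K_def q_def exp_add exp_of_nat_mult by (simp only: mult_ac)
    finally show ?thesis .
  qed
  have K: "0 \<le> K" and q: "0 \<le> q" "q < 1"
    using c by (auto simp: K_def q_def)
  have "(\<integral>\<^sup>+\<omega>. (\<Sum>n. F n \<omega>) \<partial>M) = (\<Sum>n. \<integral>\<^sup>+\<omega>. F n \<omega> \<partial>M)"
    by (intro nn_integral_suminf) measurable
  also have "\<dots> \<le> (\<Sum>n. ennreal (K * q ^ n))"
    using int_F by (intro suminf_le) auto
  also have "\<dots> < \<infinity>"
    using K q by (subst suminf_ennreal2) (auto intro!: summable_mult summable_geometric)
  finally have "AE \<omega> in M. (\<Sum>n. F n \<omega>) \<noteq> \<infinity>"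
    by (intro nn_integral_noteq_infinite) auto
  then show ?thesis
    using G(3)
  proof eventually_elim
    case (elim \<omega>)
    have "macro_content \<rho> (Suc n) (OU_peaks \<gamma> \<omega>) \<le> F n \<omega>" for n
    proof -
      define J where "J = {i\<in>I n. \<omega> \<in> G i}"
      have finJ: "finite J"
        using fin by (simp add: J_def)
      have cov: "OU_peaks \<gamma> \<omega> \<inter> macro_shell (Suc n) \<subseteq> (\<Union>x\<in>(\<lambda>i. real i / real m) ` J. {x..<x + 1})"
      proof
        fix u assume u: "u \<in> OU_peaks \<gamma> \<omega> \<inter> macro_shell (Suc n)"
        then have ue: "exp (exp 1) \<le> u" and peak: "\<gamma> * sqrt (2 * exp u * ln u) \<le> B (exp u) \<omega>"
          by (auto simp: OU_peaks_def)
        have "0 < u"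
          using ue exp_gt_zero[of "exp 1"] by linarith
        then have sh: "exp (real n) \<le> u" "u < exp (real (Suc n))"
          using u nonneg_in_macro_shell_Suc[of u n] by auto
        have "exp 1 \<le> u"
          using ue exp_ge_add_one_self[of "exp 1"] by linarith
        then have i: "\<omega> \<in> G (nat \<lfloor>u * real m\<rfloor>)"
          using elim(2) peak by blast
        define i where "i = nat \<lfloor>u * real m\<rfloor>"
        have i_le: "real i \<le> u * real m" "u * real m < real i + 1"
          using \<open>0 < u\<close> m by (auto simp: i_def)
        have "real m * exp (real n) \<le> u * real m"
          using sh m by (simp add: mult.commute)
        moreover have "real i < real m * exp (real (Suc n))"
          using i_le(1) mult_strict_right_mono[OF sh(2), of "real m"] m unfolding mult.commute[of _ "real m"] by linarith
        then have "i < nat \<lceil>real m * exp (real (Suc n))\<rceil>"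
          by linarith
        ultimately have "i \<in> J"
          using i_le i unfolding J_def I_def i_def[symmetric] by auto
        moreover have "u \<in> {real i / real m..<real i / real m + 1}"
        proof -
          have "1 / real m \<le> 1"
            using m by simp
          moreover have "real i / real m \<le> u" "u < real i / real m + 1 / real m"
            using i_le m by (auto simp: field_simps)
          ultimately show ?thesis
            by auto
        qed
        ultimately show "u \<in> (\<Union>x\<in>(\<lambda>i. real i / real m) ` J. {x..<x + 1})"
          by blast
      qed
      have "macro_content \<rho> (Suc n) (OU_peaks \<gamma> \<omega>) \<le>
          ennreal (real (card ((\<lambda>i. real i / real m) ` J)) * exp (- real (Suc n) * \<rho>))"
        using finJ cov by (intro macro_content_le) auto
      also have "\<dots> \<le> ennreal (real (card J) * exp (- real (Suc n) * \<rho>))"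
        using card_image_le[OF finJ] by (intro ennreal_leI mult_right_mono) auto
      also have "\<dots> = ennreal (exp (- real (Suc n) * \<rho>)) * of_nat (card J)"
        by (simp add: ennreal_mult mult.commute ennreal_of_nat_eq_real_of_nat)
      also have "of_nat (card J) = (\<Sum>i\<in>I n. indicator (G i) \<omega> :: ennreal)"
        using fin[of n] by (simp add: J_def indicator_def sum.If_cases Int_def)
      finally show ?thesis
        unfolding F_def .
    qed
    then have "(\<Sum>n. macro_content \<rho> (Suc n) (OU_peaks \<gamma> \<omega>)) \<le> (\<Sum>n. F n \<omega>)"
      by (intro suminf_le) auto
    then show ?case
      using elim(1) by (auto simp: less_top[symmetric] top_unique)
  qed
qed

lemma Dim_H_OU_peaks_le:
  assumes \<gamma>: "0 < \<gamma>" "\<gamma> \<le> 1"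
  shows "AE \<omega> in M. Dim_H (OU_peaks \<gamma> \<omega>) \<le> ereal (1 - \<gamma>\<^sup>2)"
proof -
  have "AE \<omega> in M. \<forall>k. (\<Sum>n. macro_content (1 - \<gamma>\<^sup>2 + 1 / real (Suc k)) (Suc n) (OU_peaks \<gamma> \<omega>)) < \<infinity>"
    unfolding AE_all_countable using \<gamma> by (intro allI OU_peaks_content_summable) auto
  then show ?thesis
  proof eventually_elim
    case (elim \<omega>)
    have "0 < 1 - \<gamma>\<^sup>2 + 1 / real (Suc k)" for k
      using \<gamma> by (intro add_nonneg_pos) (auto simp: power_le_one)
    then show ?case
      using elim by (intro Dim_H_le_of_seq[OF Dim_H_le]) auto
  qed
qed

section \<open>Lower estimate for the Ornstein-Uhlenbeck dimension\<close>

text \<open>The level is \<open>2 * sqrt (ln (j + 1))\<close> standard deviations, so the tail is at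
  most \<open>(j + 1) powr (- 2)\<close> and summable, whatever the times \<open>a j\<close>. It
  bounds what the path before an increment can take away from it.\<close>

lemma eventually_gt_neg_sqrt_ln:
  assumes a: "\<And>j. 0 < a j"
  shows "AE \<omega> in M. eventually (\<lambda>j. - (2 * sqrt (a j * ln (real (Suc j)))) < B (a j) \<omega>) sequentially"
proof -
  define x where "x j = 2 * sqrt (a j * ln (real (Suc j)))" for j
  define A where "A j = {\<omega>\<in>space M. B (a j) \<omega> - B 0 \<omega> \<le> - x j}" for j
  have x: "0 \<le> x j" for j
    using a[of j] by (simp add: x_def)
  have A_sets: "A j \<in> events" for j
    unfolding A_def using increment_measurable[of 0 "a j"] less_imp_le[OF a[of j]] by measurable
  have "prob (A j) \<le> real (Suc j) powr (- 2)" for j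
  proof -
    have "(x j)\<^sup>2 = 4 * (a j * ln (real (Suc j)))"
      using a[of j] by (simp add: x_def power_mult_distrib)
    then have "- (x j)\<^sup>2 / (2 * (a j - 0)) = - 2 * ln (real (Suc j))"
      using a[of j] by (simp add: field_simps)
    then show ?thesis
      using increment_tail_upper_neg[of 0 "a j" "x j"] a[of j] x[of j] by (simp add: A_def powr_def)
  qed
  moreover have "summable (\<lambda>j. real (Suc j) powr (- 2))"
    using summable_Suc_iff[of "\<lambda>j. real j powr (- 2)"] by (simp add: summable_real_powr_iff)
  ultimately have "summable (\<lambda>j. prob (A j))"
    by (intro summable_comparison_test[where f="\<lambda>j. prob (A j)"]) auto
  then have "AE \<omega> in M. eventually (\<lambda>j. \<omega> \<in> space M - A j) sequentially"
    using A_sets by (intro borel_cantelli_AE1) (auto simp: emeasure_eq_measure)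
  then show ?thesis
    using start_zero
  proof eventually_elim
    case (elim \<omega>)
    show ?case
      using elim(1) by eventually_elim (use elim(2) in \<open>auto simp: A_def x_def\<close>)
  qed
qed

text \<open>A block contains about \<open>exp (n * \<beta>)\<close> independent trials with success
  probability at least \<open>exp (- (n + 1) * b)\<close>, where \<open>b < \<beta>\<close>, so some
  block in the shell fails only with summable probability. About
  \<open>exp (n * (1 - \<beta>))\<close> blocks with peaks balance a cost of at most that order.
  Quantifying \<rho> inside the almost sure statement leaves one null set for each \<beta>.\<close>

lemma OU_peaks_thick:
  assumes \<gamma>: "0 < \<gamma>" "\<gamma>\<^sup>2 < \<beta>" and \<beta>: "\<beta> < 1"
  shows "\<exists>c>0. AE \<omega> in M. eventually (\<lambda>n. \<forall>\<rho>. 0 < \<rho> \<longrightarrow> \<rho> \<le> 1 - \<beta> \<longrightarrow>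
    ennreal c \<le> macro_content \<rho> (Suc n) (OU_peaks \<gamma> \<omega>)) sequentially"
proof -
  have "\<gamma> < sqrt \<beta>"
    using \<gamma> real_less_rsqrt by blast
  then obtain \<gamma>' where \<gamma>': "\<gamma> < \<gamma>'" "\<gamma>' < sqrt \<beta>"
    using dense by blast
  have "\<gamma>'\<^sup>2 < \<beta>"
    using \<gamma> \<gamma>' by (metis less_trans real_sqrt_less_iff real_sqrt_abs abs_of_pos)
  then obtain b where b: "\<gamma>'\<^sup>2 < b" "b < \<beta>"
    using dense by blast
  have b0: "0 < b"
    using b by (meson le_less_trans zero_le_power2)
  \<comment> \<open>A large \<open>g\<close> serves two purposes: the increment keeps the share
    \<open>1 - exp (- g)\<close> of the variance, and the part of the path before it is small
    against the slack \<open>\<gamma>' - \<gamma>\<close>.\<close>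
  have "eventually (\<lambda>g. \<gamma>'\<^sup>2 / (1 - exp (- real g)) < b) sequentially"
    using b by real_asymp
  moreover have "eventually (\<lambda>g. sqrt 2 * exp (- real g / 2) < \<gamma>' - \<gamma>) sequentially"
    using \<gamma>' by real_asymp
  ultimately have "eventually (\<lambda>g. 0 < g \<and> \<gamma>'\<^sup>2 / (1 - exp (- real g)) < b \<and> sqrt 2 * exp (- real g / 2) < \<gamma>' - \<gamma>) sequentially"
    using eventually_gt_at_top[of 0] by eventually_elim auto
  then obtain g :: nat where g: "0 < g" "\<gamma>'\<^sup>2 / (1 - exp (- real g)) < b"
    "sqrt 2 * exp (- real g / 2) < \<gamma>' - \<gamma>"
    by (auto dest!: eventually_happens)
  \<comment> \<open>The squared standardised threshold of the \<open>i\<close>-th increment is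
    \<open>2 * a * ln (v i)\<close>, so its tail is about \<open>v i powr (- a)\<close>; the margin
    \<open>a < b\<close> absorbs the constants and the square root of the logarithm.\<close>
  define a where "a = \<gamma>'\<^sup>2 / (1 - exp (- real g))"
  have eg: "exp (- real g) < 1"
    using g by simp
  have a: "0 < a" "a < b"
    using g eg \<gamma> \<gamma>' by (auto simp: a_def)
  define t where "t i = exp (real g * real i)" for i
  have t_Suc: "t i < t (Suc i)" "0 < t i" for i
    using g by (auto simp: t_def)
  define v where "v i = real g * real (Suc i)" for i
  define h where "h i = \<gamma>' * sqrt (2 * exp (v i) * ln (v i))" for i
  define W where "W i \<omega> = B (t (Suc i)) \<omega> - B (t i) \<omega>" for i \<omega>
  have W_meas [measurable]: "W i \<in> borel_measurable M" for i
    unfolding W_def using t_Suc by (intro increment_measurable less_imp_le)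
  have t_v: "t (Suc i) = exp (v i)" for i
    by (simp add: t_def v_def)
  have t_eq: "t i = exp (- real g) * exp (v i)" for i
    unfolding t_def v_def exp_add[symmetric] by (simp add: algebra_simps)
  have v_ge: "real (Suc i) \<le> v i" for i
    using g by (simp add: v_def mult_le_cancel_right1)

  have "eventually (\<lambda>u. u powr (- b) \<le> exp (- 3 / 2 - a * ln u) / (sqrt (2 * a * ln u) * sqrt (2 * pi))) at_top"
    using a by real_asymp
  then have ev: "eventually (\<lambda>u. 1 \<le> 2 * a * ln u \<and>
      u powr (- b) \<le> exp (- 3 / 2 - a * ln u) / (sqrt (2 * a * ln u) * sqrt (2 * pi))) at_top"
  proof (rule eventually_conj[rotated])
    show "eventually (\<lambda>u. 1 \<le> 2 * a * ln u) at_top"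
      using a by real_asymp
  qed
  then obtain u0 where u0: "\<And>u. u0 \<le> u \<Longrightarrow> 1 \<le> 2 * a * ln u"
    "\<And>u. u0 \<le> u \<Longrightarrow> u powr (- b) \<le> exp (- 3 / 2 - a * ln u) / (sqrt (2 * a * ln u) * sqrt (2 * pi))"
    unfolding eventually_at_top_linorder by blast

  have prob_W: "v i powr (- b) \<le> prob {\<omega>\<in>space M. h i \<le> W i \<omega>}" if "u0 \<le> v i" for i
  proof -
    define z where "z = sqrt (2 * a * ln (v i))"
    have z: "1 \<le> z" "z\<^sup>2 = 2 * a * ln (v i)"
      using u0(1)[OF that] by (auto simp: z_def)
    have "a * (1 - exp (- real g)) = \<gamma>'\<^sup>2"
      using eg by (simp add: a_def)
    moreover have "t (Suc i) - t i = (1 - exp (- real g)) * exp (v i)"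
      by (simp add: t_v t_eq[of i] left_diff_distrib)
    ultimately have "2 * a * ln (v i) * (t (Suc i) - t i) = \<gamma>'\<^sup>2 * (2 * exp (v i) * ln (v i))"
      by (metis mult.assoc mult.left_commute mult.commute)
    then have "z * sqrt (t (Suc i) - t i) = sqrt (\<gamma>'\<^sup>2 * (2 * exp (v i) * ln (v i)))"
      unfolding z_def real_sqrt_mult[symmetric] by simp
    then have "z * sqrt (t (Suc i) - t i) = h i"
      using \<gamma> \<gamma>' by (simp add: h_def real_sqrt_mult)
    moreover have "v i powr (- b) \<le> exp (- 3 / 2 - z\<^sup>2 / 2) / (z * sqrt (2 * pi))"
      using u0(2)[OF that] unfolding z(2) by (simp add: z_def)
    moreover have "exp (- 3 / 2 - z\<^sup>2 / 2) / (z * sqrt (2 * pi)) \<le>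
        prob {\<omega>\<in>space M. z * sqrt (t (Suc i) - t i) \<le> B (t (Suc i)) \<omega> - B (t i) \<omega>}"
      using t_Suc[of i] z(1) by (intro increment_tail_lower) auto
    ultimately show ?thesis
      unfolding W_def by simp
  qed

  have indep: "indep_vars (\<lambda>_. borel) W {..<n}" for n
    unfolding W_def using t_Suc by (intro indep_increments) (auto intro: less_imp_le)

  define l where "l n = nat \<lceil>exp (real n * \<beta>)\<rceil>" for n :: nat
  define L where "L n = real g * real (l n)" for n
  have l_ge: "exp (real n * \<beta>) \<le> real (l n)" "real (l n) \<le> 2 * exp (real n * \<beta>)" "1 \<le> l n" for n
  proof -
    show *: "exp (real n * \<beta>) \<le> real (l n)"
      unfolding l_def by linarith
    have "0 \<le> \<beta>"
      using b b0 by linarith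
    then have "1 \<le> exp (real n * \<beta>)"
      by simp
    then show "1 \<le> l n" "real (l n) \<le> 2 * exp (real n * \<beta>)"
      using * unfolding l_def by linarith+
  qed
  have L1: "1 \<le> L n" for n
    using g l_ge(3)[of n] unfolding L_def by (metis One_nat_def Suc_leI mult_le_mono nat_mult_1 of_nat_1 of_nat_le_iff of_nat_mult)
  \<comment> \<open>Only blocks lying wholly inside the shell are counted; discarding the incomplete
    ones at both ends accounts for the \<open>- 2\<close> in \<open>J_card_ge\<close>.\<close>
  define J where "J n = {j. exp (real n) \<le> L n * real j \<and> L n * (real j + 1) < exp (real (Suc n))}" for n
  have J_sub: "J n \<subseteq> {..<nat \<lceil>exp (real (Suc n))\<rceil>}" for n
  proof
    fix j assume "j \<in> J n"
    then have "L n * (real j + 1) < exp (real (Suc n))"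
      by (simp add: J_def)
    moreover have "1 * (real j + 1) \<le> L n * (real j + 1)"
      using L1[of n] by (intro mult_right_mono) auto
    ultimately have "1 * (real j + 1) < exp (real (Suc n))"
      by (rule order.strict_trans1[rotated])
    then have "real j + 1 < exp (real (Suc n))"
      by simp
    then have "j < nat \<lceil>exp (real (Suc n))\<rceil>"
      by linarith
    then show "j \<in> {..<nat \<lceil>exp (real (Suc n))\<rceil>}"
      by simp
  qed
  have J_fin: "finite (J n)" for n
    by (rule finite_subset[OF J_sub]) simp
  have J_card_le: "real (card (J n)) \<le> exp (real n + 1) + 1" for n
  proof -
    have "real (card (J n)) \<le> real (card {..<nat \<lceil>exp (real (Suc n))\<rceil>})"
      unfolding of_nat_le_iff by (intro card_mono J_sub) simp
    also have "\<dots> \<le> exp (real n + 1) + 1"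
      using exp_gt_zero[of "real n + 1"] by (simp add: add.commute del: exp_gt_zero) linarith
    finally show ?thesis .
  qed
  have J_card_ge: "exp (real n) / L n - 2 \<le> real (card (J n))" for n
  proof -
    define p where "p = nat \<lceil>exp (real n) / L n\<rceil>"
    define q where "q = nat \<lceil>exp (real (Suc n)) / L n\<rceil> - 1"
    have L0: "0 < L n"
      using L1[of n] by linarith
    have "{p..<q} \<subseteq> J n"
    proof
      fix j assume j: "j \<in> {p..<q}"
      then have "exp (real n) / L n \<le> real j"
        unfolding p_def by simp
      moreover have "real j + 1 < exp (real (Suc n)) / L n"
      proof -
        have "j + 1 < nat \<lceil>exp (real (Suc n)) / L n\<rceil>"
          using j unfolding q_def atLeastLessThan_iff by linarith
        then show ?thesis
          by linarith
      qed
      ultimately show "j \<in> J n"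
        using L0 by (simp add: J_def pos_divide_le_eq pos_less_divide_eq mult.commute)
    qed
    then have "card {p..<q} \<le> card (J n)"
      by (intro card_mono J_fin)
    then have "real q - real p \<le> real (card (J n))"
      by simp
    moreover have "real p \<le> exp (real n) / L n + 1"
      using L0 unfolding p_def by (simp add: of_nat_nat)
    moreover have "exp (real (Suc n)) / L n - 1 \<le> real q"
      unfolding q_def by linarith
    moreover have "2 * (exp (real n) / L n) \<le> exp (real (Suc n)) / L n"
    proof -
      have "2 * exp (real n) \<le> exp 1 * exp (real n)"
        using exp_ge_add_one_self[of 1] by (intro mult_right_mono) auto
      then have "2 * exp (real n) \<le> exp (real (Suc n))"
        by (simp add: exp_add)
      then show ?thesis
        using L0 by (simp add: divide_right_mono)
    qed
    ultimately show ?thesis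
      by linarith
  qed

  \<comment> \<open>\<open>v i\<close> is the right end of the \<open>i\<close>-th increment and
    involves \<open>Suc i\<close>, so the points of block \<open>j\<close> lie in
    \<open>(L j, L (j + 1)]\<close>, as \<open>macro_content_ge_blocks\<close> requires.\<close>
  define Bl where "Bl n j = {j * l n..<Suc j * l n}" for n j
  have v_block: "L n * real j < v i \<and> v i \<le> L n * (real j + 1)" if "i \<in> Bl n j" for n i j
  proof -
    have "j * l n < Suc i" "Suc i \<le> Suc j * l n"
      using that by (auto simp: Bl_def)
    then have "real (j * l n) < real (Suc i)" "real (Suc i) \<le> real (Suc j * l n)"
      by (simp_all only: of_nat_less_iff of_nat_le_iff)
    then have "real g * real (j * l n) < v i" "v i \<le> real g * real (Suc j * l n)"
      using g unfolding v_def by (auto intro!: mult_strict_left_mono mult_left_mono simp del: of_nat_mult of_nat_Suc)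
    then show ?thesis
      by (simp add: L_def algebra_simps)
  qed
  define F where "F n = (\<Union>j\<in>J n. {\<omega>\<in>space M. \<forall>i\<in>Bl n j. W i \<omega> < h i})" for n
  have F_sets: "F n \<in> events" for n
    unfolding F_def Bl_def using J_fin by measurable
  have "eventually (\<lambda>n. prob (F n) \<le> exp (- real n)) sequentially"
  proof -
    have "eventually (\<lambda>n. u0 \<le> exp (real n)) sequentially"
      by real_asymp
    \<comment> \<open>Number of blocks times the probability that all trials in one fail; the inner
      exponent is \<open>- exp (n * \<beta> - (n + 1) * b)\<close> with
      \<open>b < \<beta>\<close>.\<close>
    moreover have "eventually (\<lambda>n. (exp (real n + 1) + 1) * exp (- exp (real n * \<beta>) * exp (- (real n + 1) * b)) \<le> exp (- real n)) sequentially"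
      using b b0 by real_asymp
    ultimately show ?thesis
    proof eventually_elim
      case (elim n)
      define p where "p = exp (- (real n + 1) * b)"
      have block_prob: "prob {\<omega>\<in>space M. \<forall>i\<in>Bl n j. W i \<omega> < h i} \<le> exp (- exp (real n * \<beta>) * p)" if j: "j \<in> J n" for j
      proof -
        have ne: "Bl n j \<noteq> {}"
          using l_ge(3)[of n] by (simp add: Bl_def)
        have "{\<omega>\<in>space M. \<forall>i\<in>Bl n j. W i \<omega> < h i} = (\<Inter>i\<in>Bl n j. W i -` {..<h i} \<inter> space M)"
          using ne by auto
        then have "prob {\<omega>\<in>space M. \<forall>i\<in>Bl n j. W i \<omega> < h i} = prob (\<Inter>i\<in>Bl n j. W i -` {..<h i} \<inter> space M)"
          by (simp only:)
        also have "\<dots> = (\<Prod>i\<in>Bl n j. prob (W i -` {..<h i} \<inter> space M))"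
          using ne by (intro indep_varsD[OF indep[of "Suc j * l n"]]) (auto simp: Bl_def)
        also have "\<dots> \<le> (\<Prod>i\<in>Bl n j. exp (- p))"
        proof (intro prod_mono conjI)
          fix i assume i: "i \<in> Bl n j"
          have vi: "exp (real n) < v i" "v i < exp (real n + 1)"
            using v_block[OF i] j by (auto simp: J_def add.commute)
          have "p = exp (real n + 1) powr (- b)"
            by (simp add: p_def powr_def algebra_simps)
          also have "\<dots> \<le> v i powr (- b)"
            using vi b0 exp_gt_zero[of "real n"] by (intro powr_mono2') (auto intro: less_trans simp del: exp_gt_zero)
          also have "\<dots> \<le> prob {\<omega>\<in>space M. h i \<le> W i \<omega>}"
            using vi elim(1) by (intro prob_W) simp
          finally have p_le: "p \<le> prob {\<omega>\<in>space M. h i \<le> W i \<omega>}" .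
          have "W i -` {..<h i} \<inter> space M = space M - {\<omega>\<in>space M. h i \<le> W i \<omega>}"
            by auto
          then have "prob (W i -` {..<h i} \<inter> space M) = 1 - prob {\<omega>\<in>space M. h i \<le> W i \<omega>}"
            by (simp add: prob_compl)
          also have "\<dots> \<le> exp (- p)"
            using p_le exp_ge_add_one_self[of "- p"] by linarith
          finally show "prob (W i -` {..<h i} \<inter> space M) \<le> exp (- p)" .
        qed simp
        also have "\<dots> = exp (- (real (l n) * p))"
          by (simp add: Bl_def exp_of_nat_mult[symmetric])
        also have "\<dots> \<le> exp (- exp (real n * \<beta>) * p)"
          using l_ge(1)[of n] by (simp add: p_def mult_right_mono)
        finally show ?thesis .
      qed
      have "prob (F n) \<le> (\<Sum>j\<in>J n. prob {\<omega>\<in>space M. \<forall>i\<in>Bl n j. W i \<omega> < h i})"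
        unfolding F_def Bl_def by (intro finite_measure_subadditive_finite J_fin) auto
      also have "\<dots> \<le> real (card (J n)) * exp (- exp (real n * \<beta>) * p)"
        using block_prob by (intro sum_bounded_above)
      also have "\<dots> \<le> (exp (real n + 1) + 1) * exp (- exp (real n * \<beta>) * p)"
        by (intro mult_right_mono J_card_le) simp
      also have "\<dots> \<le> exp (- real n)"
        using elim(2) by (simp add: p_def)
      finally show ?case .
    qed
  qed
  then have "eventually (\<lambda>n. norm (prob (F n)) \<le> exp (- 1) ^ n) sequentially"
    by (simp add: exp_of_nat_mult[symmetric])
  moreover have "summable (\<lambda>n. exp (- 1) ^ n :: real)"
    by (intro summable_geometric) simp
  ultimately have "summable (\<lambda>n. prob (F n))"
    by (rule summable_comparison_test_ev)
  then have "AE \<omega> in M. eventually (\<lambda>n. \<omega> \<in> space M - F n) sequentially"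
    using F_sets by (intro borel_cantelli_AE1) (auto simp: emeasure_eq_measure)
  moreover have "AE \<omega> in M. eventually (\<lambda>i. - (2 * sqrt (t i * ln (real (Suc i)))) < B (t i) \<omega>) sequentially"
    by (intro eventually_gt_neg_sqrt_ln t_Suc)
  \<comment> \<open>With \<open>D = exp n / L n\<close> there are at least \<open>D / 2\<close> good
    blocks, and the denominator of the content bound is at most
    \<open>exp 1 * (1 + 4 * g) * D\<close>; this is the origin of the constant.\<close>
  ultimately have "AE \<omega> in M. eventually (\<lambda>n. \<forall>\<rho>. 0 < \<rho> \<longrightarrow> \<rho> \<le> 1 - \<beta> \<longrightarrow>
    ennreal (1 / (2 * (1 + 4 * real g)) / exp 1) \<le> macro_content \<rho> (Suc n) (OU_peaks \<gamma> \<omega>)) sequentially"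
  proof eventually_elim
    case (elim \<omega>)
    obtain i0 where i0: "\<And>i. i0 \<le> i \<Longrightarrow> - (2 * sqrt (t i * ln (real (Suc i)))) < B (t i) \<omega>"
      using elim(2) by (auto simp: eventually_sequentially)
    have peak: "v i \<in> OU_peaks \<gamma> \<omega>" if i: "h i \<le> W i \<omega>" "i0 \<le> i" "exp (exp 1) \<le> v i" for i
    proof -
      have "1 \<le> v i"
        using v_ge[of i] by simp
      then have lnv: "0 \<le> ln (v i)"
        by simp
      \<comment> \<open>The possible deficit of \<open>B (t i)\<close> is at most
        \<open>\<gamma>' - \<gamma>\<close> times the boundary, so reaching level \<gamma>' by the
        increment leaves level \<gamma> for the path.\<close>
      have "t i * ln (real (Suc i)) \<le> t i * ln (v i)"
        using t_Suc[of i] v_ge[of i] by (intro mult_left_mono) auto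
      then have "2 * sqrt (t i * ln (real (Suc i))) \<le> 2 * sqrt (exp (- real g) * exp (v i) * ln (v i))"
        by (simp add: t_eq)
      also have "\<dots> = sqrt 2 * exp (- real g / 2) * sqrt (2 * exp (v i) * ln (v i))"
      proof -
        have "exp (- real g) = (exp (- real g / 2))\<^sup>2"
          by (simp add: exp_of_nat_mult[symmetric])
        then have "sqrt (exp (- real g)) = exp (- real g / 2)"
          by simp
        then show ?thesis
          by (simp add: real_sqrt_mult)
      qed
      also have "\<dots> \<le> (\<gamma>' - \<gamma>) * sqrt (2 * exp (v i) * ln (v i))"
        using g(3) lnv by (intro mult_right_mono) auto
      finally have "- ((\<gamma>' - \<gamma>) * sqrt (2 * exp (v i) * ln (v i))) \<le> B (t i) \<omega>"
        using i0[OF i(2)] by linarith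
      then have "\<gamma> * sqrt (2 * exp (v i) * ln (v i)) \<le> B (exp (v i)) \<omega>"
        using i(1) unfolding W_def h_def t_v by (simp add: algebra_simps)
      then show ?thesis
        using i(3) by (simp add: OU_peaks_def)
    qed
    have "eventually (\<lambda>n. exp (exp 1) \<le> exp (real n)) sequentially"
      by real_asymp
    moreover have "eventually (\<lambda>n. real g * (real i0 + 1) \<le> exp (real n)) sequentially"
      by real_asymp
    moreover have "eventually (\<lambda>n. 4 \<le> exp (real n * (1 - \<beta>)) / (2 * real g)) sequentially"
      using g(1) \<beta> by real_asymp
    ultimately show ?case
      using elim(1)
    proof eventually_elim
      case (elim n)
      have "\<exists>i\<in>Bl n j. h i \<le> W i \<omega>" if "j \<in> J n" for j
        using elim(4) that by (auto simp: F_def not_less)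
      then obtain \<iota> where \<iota>: "\<And>j. j \<in> J n \<Longrightarrow> \<iota> j \<in> Bl n j" "\<And>j. j \<in> J n \<Longrightarrow> h (\<iota> j) \<le> W (\<iota> j) \<omega>"
        by metis
      have v\<iota>: "exp (real n) \<le> v (\<iota> j)" "v (\<iota> j) < exp (real (Suc n))" if "j \<in> J n" for j
        using v_block[OF \<iota>(1)[OF that]] that by (auto simp: J_def)
      have mem: "v (\<iota> j) \<in> OU_peaks \<gamma> \<omega> \<inter> macro_shell (Suc n)" if "j \<in> J n" for j
      proof
        have "real g * (real i0 + 1) \<le> real g * (real (\<iota> j) + 1)"
          using v\<iota>[OF that] elim(2) by (simp add: v_def algebra_simps)
        then have "i0 \<le> \<iota> j"
          using g(1) by simp
        then show "v (\<iota> j) \<in> OU_peaks \<gamma> \<omega>"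
          using \<iota>(2)[OF that] order.trans[OF elim(1) v\<iota>(1)[OF that]] by (intro peak)
        have "0 \<le> v (\<iota> j)"
          by (simp add: v_def)
        then show "v (\<iota> j) \<in> macro_shell (Suc n)"
          using v\<iota>[OF that] nonneg_in_macro_shell_Suc by blast
      qed
      define D where "D = exp (real n) / L n"
      have L0: "0 < L n"
        using L1[of n] by linarith
      have D_ge: "exp (real n * (1 - \<beta>)) / (2 * real g) \<le> D"
      proof -
        have "L n \<le> real g * (2 * exp (real n * \<beta>))"
          unfolding L_def using l_ge(2)[of n] by (intro mult_left_mono) auto
        then have "exp (real n) / (real g * (2 * exp (real n * \<beta>))) \<le> D"
          unfolding D_def using L0 g by (intro divide_left_mono) auto
        moreover have "exp (real n) / (real g * (2 * exp (real n * \<beta>))) = exp (real n * (1 - \<beta>)) / (2 * real g)"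
          by (simp add: right_diff_distrib exp_diff)
        ultimately show ?thesis
          by simp
      qed
      have D4: "4 \<le> D"
        using D_ge elim(3) by linarith
      show ?case
      proof (intro allI impI)
        fix \<rho> assume \<rho>: "0 < \<rho>" "\<rho> \<le> 1 - \<beta>"
        define D' where "D' = exp (real (Suc n)) / L n + 2 * exp (real (Suc n) * \<rho>)"
        have D': "0 < D'"
          using L0 by (auto simp: D'_def intro!: add_pos_pos)
        have "ennreal (real (card (J n)) / D') \<le> macro_content \<rho> (Suc n) (OU_peaks \<gamma> \<omega>)"
          unfolding D'_def using \<rho> b b0 mem v_block[OF \<iota>(1)] L0 J_fin
          by (intro macro_content_ge_blocks[where u="\<lambda>j. v (\<iota> j)"]) (auto simp del: macro_shell.simps)
        moreover have "1 / (2 * (1 + 4 * real g)) / exp 1 \<le> real (card (J n)) / D'"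
        proof -
          have "exp (real (Suc n) * \<rho>) \<le> exp 1 * exp (real n * (1 - \<beta>))"
          proof -
            have "real (Suc n) * \<rho> \<le> real (Suc n) * (1 - \<beta>)"
              using \<rho> by (intro mult_left_mono) auto
            also have "\<dots> \<le> 1 + real n * (1 - \<beta>)"
              using b b0 by (simp add: algebra_simps)
            finally show ?thesis
              by (simp add: exp_add[symmetric])
          qed
          also have "\<dots> \<le> exp 1 * (2 * real g * D)"
            using D_ge g(1) by (intro mult_left_mono) (auto simp: field_simps)
          finally have "D' \<le> exp 1 * D + 2 * (exp 1 * (2 * real g * D))"
            unfolding D'_def D_def by (simp add: exp_add)
          also have "\<dots> = exp 1 * (1 + 4 * real g) * D"
            by (simp add: algebra_simps)
          finally have "D' \<le> exp 1 * (1 + 4 * real g) * D" .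
          moreover have "D / 2 \<le> real (card (J n))"
            using J_card_ge[of n, folded D_def] D4 by linarith
          ultimately have "(D / 2) / (exp 1 * (1 + 4 * real g) * D) \<le> real (card (J n)) / D'"
            using D' D4 by (intro frac_le) auto
          moreover have "(D / 2) / (exp 1 * (1 + 4 * real g) * D) = 1 / (2 * (1 + 4 * real g)) / exp 1"
            using D4 by simp
          ultimately show ?thesis
            by simp
        qed
        ultimately show "ennreal (1 / (2 * (1 + 4 * real g)) / exp 1) \<le> macro_content \<rho> (Suc n) (OU_peaks \<gamma> \<omega>)"
          by (meson ennreal_leI order.trans)
      qed
    qed
  qed
  then show ?thesis
    by (intro exI[of _ "1 / (2 * (1 + 4 * real g)) / exp 1"]) auto
qed

text \<open>Contents eventually above a positive constant cannot be summable. A sequence of \<beta>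
  decreasing to \<open>\<gamma>\<^sup>2\<close> reaches every \<rho> below
  \<open>1 - \<gamma>\<^sup>2\<close> outside one null set.\<close>

lemma Dim_H_OU_peaks_ge:
  assumes \<gamma>: "0 < \<gamma>"
  shows "AE \<omega> in M. ereal (1 - \<gamma>\<^sup>2) \<le> Dim_H (OU_peaks \<gamma> \<omega>)"
proof -
  define \<beta> where "\<beta> k = \<gamma>\<^sup>2 + 1 / real (Suc k)" for k
  have "AE \<omega> in M. \<beta> k < 1 \<longrightarrow> (\<forall>\<rho>. 0 < \<rho> \<longrightarrow> \<rho> \<le> 1 - \<beta> k \<longrightarrow>
      (\<Sum>n. macro_content \<rho> (Suc n) (OU_peaks \<gamma> \<omega>)) = \<infinity>)" for k
  proof (cases "\<beta> k < 1")
    case True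
    moreover have "\<gamma>\<^sup>2 < \<beta> k"
      by (simp add: \<beta>_def)
    ultimately obtain c where c: "0 < c" and AE: "AE \<omega> in M. eventually (\<lambda>n. \<forall>\<rho>. 0 < \<rho> \<longrightarrow> \<rho> \<le> 1 - \<beta> k \<longrightarrow>
        ennreal c \<le> macro_content \<rho> (Suc n) (OU_peaks \<gamma> \<omega>)) sequentially"
      using OU_peaks_thick[OF \<gamma>] by blast
    from AE show ?thesis
    proof (eventually_elim, intro impI allI)
      fix \<omega> \<rho>
      assume ev: "eventually (\<lambda>n. \<forall>\<rho>. 0 < \<rho> \<longrightarrow> \<rho> \<le> 1 - \<beta> k \<longrightarrow>
        ennreal c \<le> macro_content \<rho> (Suc n) (OU_peaks \<gamma> \<omega>)) sequentially"
        and \<rho>: "0 < \<rho>" "\<rho> \<le> 1 - \<beta> k"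
      show "(\<Sum>n. macro_content \<rho> (Suc n) (OU_peaks \<gamma> \<omega>)) = \<infinity>"
      proof (rule suminf_ennreal_eq_top_of_subseq[where \<sigma>="\<lambda>n. n" and y="\<lambda>_. c"])
        show "eventually (\<lambda>n. ennreal c \<le> macro_content \<rho> (Suc n) (OU_peaks \<gamma> \<omega>)) sequentially"
          using ev by eventually_elim (use \<rho> in blast)
      qed (use c in \<open>auto simp: summable_const_iff\<close>)
    qed
  qed auto
  then have "AE \<omega> in M. \<forall>k. \<beta> k < 1 \<longrightarrow> (\<forall>\<rho>. 0 < \<rho> \<longrightarrow> \<rho> \<le> 1 - \<beta> k \<longrightarrow>
      (\<Sum>n. macro_content \<rho> (Suc n) (OU_peaks \<gamma> \<omega>)) = \<infinity>)"
    by (simp add: AE_all_countable)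
  then show ?thesis
  proof eventually_elim
    case (elim \<omega>)
    show ?case
    proof (rule Dim_H_ge)
      fix \<rho> assume \<rho>: "0 < \<rho>" "\<rho> < 1 - \<gamma>\<^sup>2"
      then obtain k where "1 / real (Suc k) < 1 - \<gamma>\<^sup>2 - \<rho>"
        using nat_approx_posE[of "1 - \<gamma>\<^sup>2 - \<rho>"] by auto
      then show "(\<Sum>n. macro_content \<rho> (Suc n) (OU_peaks \<gamma> \<omega>)) = \<infinity>"
        using elim \<rho> by (auto simp: \<beta>_def elim!: allE[of _ k])
    qed
  qed
qed

end

subsection \<open>Peaks of Brownian motion\<close>

text \<open>The gaps are wide enough to decouple the shells, \<open>exp (- gap / 2) * ln n \<longlonglongrightarrow> 0\<close>, and narrow
  enough to keep \<open>\<Sum>j. 1 / (n\<^sub>j * sqrt (ln n\<^sub>j))\<close> divergent.\<close>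

definition sparse_shell :: "nat \<Rightarrow> nat" where
  "sparse_shell j = (j + 3) * nat \<lceil>sqrt (ln (real (j + 3)))\<rceil>"

lemma sparse_shell_gap:
  "real (sparse_shell j) + sqrt (ln (real (Suc j + 3))) \<le> real (sparse_shell (Suc j))"
proof -
  define c where "c i = nat \<lceil>sqrt (ln (real (i + 3)))\<rceil>" for i
  have "ln (real (j + 3)) \<le> ln (real (Suc j + 3))"
    by (subst ln_le_cancel_iff) auto
  then have "c j \<le> c (Suc j)"
    unfolding c_def by (intro nat_mono ceiling_mono) simp
  then have "(j + 3) * c j + c (Suc j) \<le> (j + 3) * c (Suc j) + c (Suc j)"
    by (intro add_right_mono mult_le_mono2)
  also have "\<dots> = (Suc j + 3) * c (Suc j)"
    by (simp add: algebra_simps)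
  finally have "(j + 3) * c j + c (Suc j) \<le> (Suc j + 3) * c (Suc j)" .
  then have "sparse_shell j + c (Suc j) \<le> sparse_shell (Suc j)"
    by (simp add: sparse_shell_def c_def)
  then have "real (sparse_shell j) + real (c (Suc j)) \<le> real (sparse_shell (Suc j))"
    by (metis of_nat_add of_nat_le_iff)
  moreover have "sqrt (ln (real (Suc j + 3))) \<le> real (c (Suc j))"
    unfolding c_def by linarith
  ultimately show ?thesis
    by linarith
qed

lemma one_le_ln_real_add_3: "1 \<le> ln (real (j + 3))"
proof -
  have "exp 1 \<le> real (j + 3)"
    using exp_le by simp
  then show ?thesis
    by (subst ln_ge_iff) auto
qed

lemma sparse_shell_bounds:
  "j + 3 \<le> sparse_shell j" "real (sparse_shell j) + 1 \<le> 3 * real (j + 3) * sqrt (ln (real (j + 3)))"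
proof -
  define s where "s = sqrt (ln (real (j + 3)))"
  have s: "1 \<le> s"
    using one_le_ln_real_add_3[of j] by (simp add: s_def)
  have "1 \<le> nat \<lceil>s\<rceil>"
    using s by linarith
  then have "(j + 3) * 1 \<le> (j + 3) * nat \<lceil>s\<rceil>"
    by (rule mult_le_mono2)
  then show "j + 3 \<le> sparse_shell j"
    unfolding sparse_shell_def s_def by simp
  have "real (nat \<lceil>s\<rceil>) \<le> 2 * s"
    using s by linarith
  then have "real (j + 3) * real (nat \<lceil>s\<rceil>) \<le> real (j + 3) * (2 * s)"
    by (intro mult_left_mono) auto
  moreover have "1 * 1 \<le> real (j + 3) * s"
    using s by (intro mult_mono) auto
  ultimately have "real (j + 3) * real (nat \<lceil>s\<rceil>) + 1 \<le> 3 * (real (j + 3) * s)"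
    by linarith
  then show "real (sparse_shell j) + 1 \<le> 3 * real (j + 3) * sqrt (ln (real (j + 3)))"
    unfolding sparse_shell_def s_def[symmetric] by (simp only: of_nat_mult mult.assoc)
qed

lemma strict_mono_sparse_shell: "strict_mono sparse_shell"
proof (rule strict_monoI_Suc)
  fix j
  have "0 < sqrt (ln (real (Suc j + 3)))"
    using one_le_ln_real_add_3[of "Suc j"] by simp
  then have "real (sparse_shell j) < real (sparse_shell (Suc j))"
    using sparse_shell_gap[of j] by linarith
  then show "sparse_shell j < sparse_shell (Suc j)"
    by simp
qed

text \<open>The partial sums dominate the telescoping sum of \<open>ln (ln (j + 3))\<close>, by the
  tangent bound for \<open>ln\<close> applied twice.\<close>

lemma not_summable_inverse_mult_ln: "\<not> summable (\<lambda>j. 1 / (real (j + 3) * ln (real (j + 3))))"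
proof
  assume summ: "summable (\<lambda>j. 1 / (real (j + 3) * ln (real (j + 3))))"
  have step: "ln (ln (real (Suc j + 3))) - ln (ln (real (j + 3))) \<le> 1 / (real (j + 3) * ln (real (j + 3)))" for j
  proof -
    define x where "x = real (j + 3)"
    have x: "3 \<le> x" "1 \<le> ln x"
      using one_le_ln_real_add_3[of j] by (auto simp: x_def)
    have "ln (x + 1) - ln x \<le> 1 / x"
      using ln_diff_le[of "x + 1" x] x by simp
    moreover have "ln (ln (x + 1)) - ln (ln x) \<le> (ln (x + 1) - ln x) / ln x"
      using x by (intro ln_diff_le) auto
    ultimately have "ln (ln (x + 1)) - ln (ln x) \<le> (1 / x) / ln x"
      using x by (meson divide_right_mono order.trans zero_le_one)
    then show ?thesis
      by (simp add: x_def add_ac)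
  qed
  have "ln (ln (real (n + 3))) \<le> ln (ln 3) + (\<Sum>j. 1 / (real (j + 3) * ln (real (j + 3))))" for n
  proof -
    have "ln (ln (real (n + 3))) - ln (ln (real (0 + 3))) \<le> (\<Sum>j<n. 1 / (real (j + 3) * ln (real (j + 3))))"
      unfolding sum_lessThan_telescope[of "\<lambda>j. ln (ln (real (j + 3)))" n, symmetric] by (intro sum_mono step)
    also have "\<dots> \<le> (\<Sum>j. 1 / (real (j + 3) * ln (real (j + 3))))"
      using one_le_ln_real_add_3 by (intro sum_le_suminf summ) (auto intro!: divide_nonneg_nonneg mult_nonneg_nonneg order.trans[OF zero_le_one])
    finally show ?thesis
      by simp
  qed
  moreover have "eventually (\<lambda>n. c < ln (ln (real n + 3))) sequentially" for c :: real
    by real_asymp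
  then have "eventually (\<lambda>n. ln (ln 3) + (\<Sum>j. 1 / (real (j + 3) * ln (real (j + 3)))) < ln (ln (real n + 3))) sequentially" .
  ultimately show False
    by (auto dest!: eventually_happens simp: not_less[symmetric])
qed

lemma not_summable_sparse_shell:
  "\<not> summable (\<lambda>j. 1 / ((real (sparse_shell (Suc j)) + 1) * sqrt (ln (real (sparse_shell (Suc j)) + 1))))"
proof
  define f where "f j = 1 / ((real (sparse_shell j) + 1) * sqrt (ln (real (sparse_shell j) + 1)))" for j
  assume "summable (\<lambda>j. 1 / ((real (sparse_shell (Suc j)) + 1) * sqrt (ln (real (sparse_shell (Suc j)) + 1))))"
  then have "summable f"
    unfolding f_def[symmetric] by (simp add: summable_Suc_iff)
  then have "summable (\<lambda>j. 5 * f j)"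
    by (rule summable_mult)
  moreover have "eventually (\<lambda>j. norm (1 / (real (j + 3) * ln (real (j + 3)))) \<le> 5 * f j) sequentially"
  proof -
    \<comment> \<open>Replacing the shell index by its upper bound of order
      \<open>3 * j * sqrt (ln j)\<close> turns the denominator into about
      \<open>3 * j * ln j\<close>; any constant above 3, such as 5, eventually suffices.\<close>
    have "eventually (\<lambda>j. 1 / ((real j + 3) * ln (real j + 3)) \<le>
        5 * (1 / (3 * (real j + 3) * sqrt (ln (real j + 3)) * sqrt (ln (3 * (real j + 3) * sqrt (ln (real j + 3))))))) sequentially"
      by real_asymp
    then show ?thesis
    proof eventually_elim
      case (elim j)
      define F where "F = 3 * real (j + 3) * sqrt (ln (real (j + 3)))"
      define y where "y = real (sparse_shell j) + 1"
      have y: "y \<le> F" "4 \<le> y"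
        using sparse_shell_bounds[of j] by (auto simp: F_def y_def)
      have "0 < ln y" "ln y \<le> ln F"
        using y by auto
      then have "y * sqrt (ln y) \<le> F * sqrt (ln F)"
        using y by (intro mult_mono) auto
      moreover have "0 < y * sqrt (ln y)"
        using y \<open>0 < ln y\<close> by simp
      ultimately have "1 / (F * sqrt (ln F)) \<le> f j"
        unfolding f_def y_def[symmetric] by (intro divide_left_mono) auto
      moreover have "norm (1 / (real (j + 3) * ln (real (j + 3)))) = 1 / (real (j + 3) * ln (real (j + 3)))"
        using one_le_ln_real_add_3[of j] by simp
      ultimately show ?case
        using elim unfolding F_def by (simp add: mult.assoc)
    qed
  qed
  ultimately have "summable (\<lambda>j. 1 / (real (j + 3) * ln (real (j + 3))))"
    by (rule summable_comparison_test_ev[rotated])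
  then show False
    using not_summable_inverse_mult_ln by contradiction
qed

section \<open>Peaks at the critical level in the sparse shells\<close>

context standard_brownian_motion
begin

text \<open>Here \<open>r\<close> bounds \<open>sqrt (a / k)\<close>, the relative effect of the
  time before \<open>a\<close>. It raises the squared standardised threshold from
  \<open>2 * \<Lambda>\<close> by at most a multiple of \<open>r * \<Lambda>\<close>, and
  \<open>r * \<Lambda> \<le> 1\<close> keeps this bounded, so only a constant factor of the tail is
  lost.\<close>

lemma peak_prob_lower:
  fixes n :: nat and a k r :: real
  defines "\<Lambda> \<equiv> ln (real n + 1)"
  assumes k: "exp (real n) \<le> k" "k < exp (real n + 1)" and a: "0 < a" "a \<le> r\<^sup>2 * k"
    and r: "0 \<le> r" "r * \<Lambda> \<le> 1" and n: "2 \<le> \<Lambda>" and m: "1 \<le> m" "m \<le> real n + 1"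
  shows "exp (- 21 / 2) / (5 * sqrt (2 * pi)) / ((real n + 1) * sqrt \<Lambda>) \<le>
    prob {\<omega>\<in>space M. sqrt (2 * k * ln (ln k)) + 2 * sqrt (a * ln m) \<le> B k \<omega> - B a \<omega>}"
proof -
  have k0: "0 < k"
    using k(1) exp_gt_zero[of "real n"] by linarith
  have r2: "r \<le> 1 / 2"
  proof -
    have "r * 2 \<le> r * \<Lambda>"
      using n r by (intro mult_left_mono) auto
    then show ?thesis
      using r by linarith
  qed
  have rr: "r\<^sup>2 \<le> r / 2"
    using mult_left_mono[OF r2 r(1)] by (simp add: power2_eq_square)
  have ak: "a \<le> k / 4"
  proof -
    have "r\<^sup>2 * k \<le> (1 / 4) * k"
      using rr r2 k0 by (intro mult_right_mono) auto
    then show ?thesis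
      using a by simp
  qed
  define L where "L = sqrt (2 * k * ln (ln k)) + 2 * sqrt (a * ln m)"
  define z where "z = L / sqrt (k - a)"
  have s0: "0 < sqrt (k - a)"
    using ak k0 by simp
  have lnk: "real n \<le> ln k" "ln k < real n + 1"
    using k k0 by (auto simp: ln_ge_iff) (metis exp_gt_zero ln_exp ln_less_cancel_iff)
  have n6: "2 \<le> real n"
  proof (rule ccontr)
    assume "\<not> 2 \<le> real n"
    then have "real n + 1 < exp 2"
      using exp_ge_add_one_self[of 2] by linarith
    then have "ln (real n + 1) < ln (exp 2)"
      by (subst ln_less_cancel_iff) auto
    then show False
      using n by (simp add: \<Lambda>_def)
  qed
  have lnlnk: "1 / 2 \<le> ln (ln k)" "ln (ln k) \<le> \<Lambda>"
  proof -
    have "ln 2 \<le> ln (ln k)"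
      using lnk n6 by (subst ln_le_cancel_iff) auto
    then show "1 / 2 \<le> ln (ln k)"
      using ln2_ge_two_thirds by linarith
    show "ln (ln k) \<le> \<Lambda>"
      unfolding \<Lambda>_def using lnk n6 by (subst ln_le_cancel_iff) auto
  qed
  have lnm: "0 \<le> ln m" "ln m \<le> \<Lambda>"
    using m unfolding \<Lambda>_def by auto
  have z1: "1 \<le> z"
  proof -
    have "k - a \<le> 2 * k * ln (ln k)"
    proof -
      have "2 * k * (1 / 2) \<le> 2 * k * ln (ln k)"
        using k0 lnlnk(1) by (intro mult_left_mono) auto
      then show ?thesis
        using a by simp
    qed
    then have "sqrt (k - a) \<le> sqrt (2 * k * ln (ln k))"
      by simp
    then have "sqrt (k - a) \<le> L"
      unfolding L_def using a lnm by (simp add: add_increasing2)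
    then show ?thesis
      using s0 by (simp add: z_def)
  qed
  have L_le: "L \<le> sqrt (2 * \<Lambda> * k) * (1 + 2 * r)"
  proof -
    have "sqrt (2 * k * ln (ln k)) \<le> sqrt (2 * \<Lambda> * k)"
      using lnlnk k0 by simp
    moreover have "a * ln m \<le> (r\<^sup>2 * k) * \<Lambda>"
      using a lnm n by (intro mult_mono) auto
    then have "sqrt (a * ln m) \<le> sqrt (r\<^sup>2 * (2 * \<Lambda> * k))"
      using k0 n by (intro real_sqrt_le_mono) (auto simp: mult_ac elim!: order.trans)
    then have "2 * sqrt (a * ln m) \<le> 2 * (r * sqrt (2 * \<Lambda> * k))"
      using r by (simp add: real_sqrt_mult)
    ultimately have "L \<le> sqrt (2 * \<Lambda> * k) + 2 * (r * sqrt (2 * \<Lambda> * k))"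
      unfolding L_def by (rule add_mono)
    also have "\<dots> = sqrt (2 * \<Lambda> * k) * (1 + 2 * r)"
      by algebra
    finally show ?thesis .
  qed
  have z2: "z\<^sup>2 \<le> 2 * \<Lambda> + 18"
  proof -
    have L0: "0 \<le> L"
      unfolding L_def using k0 lnlnk(1) a lnm by (intro add_nonneg_nonneg) auto
    have "L\<^sup>2 \<le> (sqrt (2 * \<Lambda> * k) * (1 + 2 * r))\<^sup>2"
      using L_le L0 by (rule power_mono)
    also have "\<dots> = 2 * \<Lambda> * k * (1 + 2 * r)\<^sup>2"
      using n k0 by (simp add: power_mult_distrib)
    also have "\<dots> \<le> (2 * \<Lambda> * (1 + 9 * r)) * (k - a)"
    proof -
      \<comment> \<open>The left side comes from the slack in the threshold,
        \<open>1 - r\<^sup>2\<close> from the variance lost before \<open>a\<close>; for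
        \<open>r \<le> 1 / 2\<close> both are covered by \<open>1 + 9 * r\<close>, whence
        \<open>18 = 2 * 9\<close>.\<close>
      have "(1 + 2 * r)\<^sup>2 \<le> (1 + 9 * r) * (1 - r\<^sup>2)"
      proof -
        have "(1 + 2 * r)\<^sup>2 = 1 + 4 * r + 4 * r\<^sup>2"
          by (simp add: power2_eq_square algebra_simps)
        moreover have "(1 + 9 * r) * (1 - r\<^sup>2) = 1 + 9 * r - r\<^sup>2 - 9 * (r * r\<^sup>2)"
          by (simp add: algebra_simps)
        moreover have "r * r\<^sup>2 \<le> (1 / 2) * (r / 2)"
          using r r2 rr by (intro mult_mono) auto
        ultimately show ?thesis
          using rr r by simp
      qed
      then have "2 * \<Lambda> * k * (1 + 2 * r)\<^sup>2 \<le> 2 * \<Lambda> * k * ((1 + 9 * r) * (1 - r\<^sup>2))"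
        using n k0 by (intro mult_left_mono) auto
      also have "\<dots> = (2 * \<Lambda> * (1 + 9 * r)) * (k - r\<^sup>2 * k)"
        by (simp add: algebra_simps)
      also have "\<dots> \<le> (2 * \<Lambda> * (1 + 9 * r)) * (k - a)"
        using n r a by (intro mult_left_mono) auto
      finally show ?thesis .
    qed
    finally have "L\<^sup>2 / (k - a) \<le> 2 * \<Lambda> * (1 + 9 * r)"
      using ak k0 by (simp add: divide_le_eq)
    moreover have "z\<^sup>2 = L\<^sup>2 / (k - a)"
      using ak k0 by (simp add: z_def power_divide)
    ultimately show ?thesis
      using r(2) by (simp add: algebra_simps)
  qed
  have z_le: "z \<le> 5 * sqrt \<Lambda>"
  proof (rule power2_le_imp_le)
    show "z\<^sup>2 \<le> (5 * sqrt \<Lambda>)\<^sup>2"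
      using z2 n by (simp add: power_mult_distrib)
  qed (use n in simp)
  \<comment> \<open>\<open>21 / 2 = 3 / 2 + 18 / 2\<close> combines the tail constant with the error
    in \<open>z\<^sup>2\<close>, the 5 comes from
    \<open>2 * \<Lambda> + 18 \<le> 25 * \<Lambda>\<close>, and \<open>exp (- \<Lambda>)\<close> is
    \<open>1 / (n + 1)\<close>.\<close>
  have "exp (- 21 / 2) / (5 * sqrt (2 * pi)) / ((real n + 1) * sqrt \<Lambda>) = exp (- 21 / 2 - \<Lambda>) / (5 * sqrt \<Lambda> * sqrt (2 * pi))"
    by (simp add: \<Lambda>_def exp_diff)
  also have "\<dots> \<le> exp (- 3 / 2 - z\<^sup>2 / 2) / (z * sqrt (2 * pi))"
    using z1 z2 z_le by (intro frac_le mult_right_mono) auto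
  also have "\<dots> \<le> prob {\<omega>\<in>space M. z * sqrt (k - a) \<le> B k \<omega> - B a \<omega>}"
    using a ak k0 z1 by (intro increment_tail_lower) auto
  also have "z * sqrt (k - a) = L"
    using s0 by (simp add: z_def)
  finally show ?thesis
    unfolding L_def .
qed

lemma peaks_1_content:
  "AE \<omega> in M. \<forall>\<rho>. 0 < \<rho> \<longrightarrow> \<rho> < 1 \<longrightarrow> (\<Sum>n. macro_content \<rho> (Suc n) (peaks 1 \<omega>)) = \<infinity>"
proof -
  define n where "n j = sparse_shell (Suc j)" for j
  \<comment> \<open>An integer time at or just after the end of the preceding selected shell. The
    integer points \<open>K j\<close> of the next one lie in \<open>{a j..<a (Suc j)}\<close>, and
    these index ranges are disjoint.\<close>
  define a where "a j = nat \<lceil>exp (real (sparse_shell j) + 1)\<rceil>" for j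
  define K where "K j = {k::nat. exp (real (n j)) \<le> real k \<and> real k < exp (real (n j) + 1)}" for j
  define \<theta> where "\<theta> j k = sqrt (2 * real k * ln (ln (real k))) + 2 * sqrt (real (a j) * ln (real (Suc j)))" for j k :: nat
  define D where "D i \<omega> = B (real (Suc i)) \<omega> - B (real i) \<omega>" for i \<omega>
  \<comment> \<open>Writing the proportion through unit increments from \<open>a j\<close> on makes
    the independence of the \<open>Y j\<close> visible; the divisor, the upper end of the shell,
    keeps it at most 1.\<close>
  define f where "f j d = (\<Sum>k\<in>K j. if \<theta> j k \<le> (\<Sum>i\<in>{a j..<k}. d i) then 1 else 0 :: real) / exp (real (n j) + 1)"
    for j and d :: "nat \<Rightarrow> real"
  define Y where "Y j \<omega> = f j (\<lambda>i. D i \<omega>)" for j \<omega>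

  have a_ge: "exp (real (sparse_shell j) + 1) \<le> real (a j)" for j
    unfolding a_def by linarith
  have a_le: "real (a j) \<le> exp (real (sparse_shell j) + 2)" for j
  proof -
    have "1 \<le> exp (real (sparse_shell j) + 1)"
      by simp
    then have "real (a j) \<le> 2 * exp (real (sparse_shell j) + 1)"
      unfolding a_def by linarith
    also have "\<dots> \<le> exp 1 * exp (real (sparse_shell j) + 1)"
      using exp_ge_add_one_self[of 1] by (intro mult_right_mono) auto
    also have "\<dots> = exp (real (sparse_shell j) + 2)"
      by (simp add: exp_add[symmetric])
    finally show ?thesis .
  qed
  have a_pos: "0 < real (a j)" for j
    using a_ge[of j] exp_gt_zero[of "real (sparse_shell j) + 1"] by linarith
  have a_mono: "a i \<le> a j" if "i \<le> j" for i j
    unfolding a_def using strict_mono_less_eq[OF strict_mono_sparse_shell] that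
    by (intro nat_mono ceiling_mono) simp
  have K_less: "k < a (Suc j)" if "k \<in> K j" for j k
  proof -
    have "real k < real (a (Suc j))"
      using that a_ge[of "Suc j"] by (auto simp: K_def n_def)
    then show ?thesis
      by simp
  qed
  have K_ge: "a j \<le> k" if "k \<in> K j" for j k
  proof -
    have "a j \<le> nat \<lceil>exp (real (n j))\<rceil>"
      unfolding a_def n_def using strict_mono_less[OF strict_mono_sparse_shell, of j "Suc j"]
      by (intro nat_mono ceiling_mono) simp
    also have "\<dots> \<le> k"
      using that by (simp add: K_def)
    finally show ?thesis .
  qed
  have K_eq: "K j = {nat \<lceil>exp (real (n j))\<rceil>..<nat \<lceil>exp (real (n j) + 1)\<rceil>}" for j
    unfolding K_def by (auto, linarith+)
  have K_fin: "finite (K j)" for j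
    unfolding K_eq by simp
  have K_card_le: "real (card (K j)) \<le> exp (real (n j) + 1)" for j
  proof -
    have "1 \<le> nat \<lceil>exp (real (n j))\<rceil>"
      using exp_gt_zero[of "real (n j)"] by linarith
    then have "card (K j) \<le> nat \<lceil>exp (real (n j) + 1)\<rceil> - 1"
      unfolding K_eq card_atLeastLessThan by (rule diff_le_mono2)
    then have "real (card (K j)) \<le> real (nat \<lceil>exp (real (n j) + 1)\<rceil> - 1)"
      by (rule of_nat_mono)
    also have "\<dots> \<le> exp (real (n j) + 1)"
      using exp_gt_zero[of "real (n j) + 1"] by linarith
    finally show ?thesis .
  qed
  have K_card_ge: "exp (real (n j)) / 2 \<le> real (card (K j))" for j
  proof -
    have "real (card (K j)) \<ge> exp (real (n j) + 1) - (exp (real (n j)) + 1)"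
      unfolding K_eq card_atLeastLessThan
      using exp_gt_zero[of "real (n j)"] exp_gt_zero[of "real (n j) + 1"] by linarith
    moreover have "2 * exp (real (n j)) \<le> exp 1 * exp (real (n j))"
      using exp_ge_add_one_self[of 1] by (intro mult_right_mono) auto
    then have "2 * exp (real (n j)) \<le> exp (real (n j) + 1)"
      by (simp add: exp_add)
    moreover have "2 \<le> exp (real (n j))"
      using sparse_shell_bounds(1)[of "Suc j"] exp_ge_add_one_self[of "real (n j)"] unfolding n_def by linarith
    ultimately show ?thesis
      by linarith
  qed

  have sum_D: "(\<Sum>i\<in>{a j..<k}. D i \<omega>) = B (real k) \<omega> - B (real (a j)) \<omega>" if "k \<in> K j" for j k \<omega>
    unfolding D_def using sum_Suc_diff'[OF K_ge[OF that], of "\<lambda>i. B (real i) \<omega>"] by simp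
  have Y_eq: "Y j \<omega> = (\<Sum>k\<in>K j. if \<theta> j k \<le> B (real k) \<omega> - B (real (a j)) \<omega> then 1 else 0) / exp (real (n j) + 1)" for j \<omega>
    unfolding Y_def f_def by (intro arg_cong2[where f="(/)"] sum.cong refl) (simp add: sum_D)
  have Y_nonneg: "0 \<le> Y j \<omega>" for j \<omega>
    unfolding Y_eq by (intro divide_nonneg_nonneg sum_nonneg) auto
  have Y_le: "Y j \<omega> \<le> 1" for j \<omega>
  proof -
    have "(\<Sum>k\<in>K j. if \<theta> j k \<le> B (real k) \<omega> - B (real (a j)) \<omega> then 1 else 0 :: real) \<le> real (card (K j)) * 1"
      by (intro sum_bounded_above) auto
    then show ?thesis
      unfolding Y_eq using K_card_le[of j] by (simp add: divide_le_eq)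
  qed

  have indep_D: "indep_vars (\<lambda>_. borel) D {..<m}" for m
    unfolding D_def by (intro indep_increments) auto
  have indep_Y: "indep_vars (\<lambda>_. borel) Y {..<m}" for m
  proof -
    have disj: "disjoint_family_on (\<lambda>j. {a j..<a (Suc j)}) {..<m}"
      unfolding disjoint_family_on_def
    proof (intro ballI impI)
      fix i j :: nat assume "i \<noteq> j"
      then consider "Suc i \<le> j" | "Suc j \<le> i"
        by linarith
      then show "{a i..<a (Suc i)} \<inter> {a j..<a (Suc j)} = {}"
        using a_mono[of "Suc i" j] a_mono[of "Suc j" i] by cases auto
    qed
    have "indep_vars (\<lambda>j. PiM {a j..<a (Suc j)} (\<lambda>_. borel)) (\<lambda>j \<omega>. restrict (\<lambda>i. D i \<omega>) {a j..<a (Suc j)}) {..<m}"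
    proof (rule indep_vars_restrict[OF indep_D[of "a m"] _ disj])
      fix j assume "j \<in> {..<m}"
      then have "a (Suc j) \<le> a m"
        by (intro a_mono) simp
      then show "{a j..<a (Suc j)} \<subseteq> {..<a m}"
        by auto
    qed
    moreover have f_meas: "f j \<in> borel_measurable (PiM {a j..<a (Suc j)} (\<lambda>_. borel))" for j
    proof -
      have "(\<lambda>d. if \<theta> j k \<le> (\<Sum>i\<in>{a j..<k}. d i) then 1 else 0 :: real) \<in>
          borel_measurable (PiM {a j..<a (Suc j)} (\<lambda>_. borel))" if "k \<in> K j" for k
      proof -
        have [measurable]: "(\<lambda>d. \<Sum>i\<in>{a j..<k}. d i :: real) \<in> borel_measurable (PiM {a j..<a (Suc j)} (\<lambda>_. borel))"
          using K_less[OF that] by (intro borel_measurable_sum measurable_component_singleton) auto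
        show ?thesis
          by measurable
      qed
      then show ?thesis
        unfolding f_def by (intro borel_measurable_divide borel_measurable_sum) auto
    qed
    ultimately have "indep_vars (\<lambda>_. borel) (\<lambda>j \<omega>. f j (restrict (\<lambda>i. D i \<omega>) {a j..<a (Suc j)})) {..<m}"
      by (rule indep_vars_compose2)
    moreover have "f j (restrict (\<lambda>i. D i \<omega>) {a j..<a (Suc j)}) = Y j \<omega>" for j \<omega>
    proof -
      have "(\<Sum>i\<in>{a j..<k}. restrict (\<lambda>i. D i \<omega>) {a j..<a (Suc j)} i) = (\<Sum>i\<in>{a j..<k}. D i \<omega>)" if "k \<in> K j" for k
        using K_less[OF that] by (intro sum.cong) auto
      then show ?thesis
        unfolding Y_def f_def by (intro arg_cong2[where f="(/)"] sum.cong refl) simp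
    qed
    ultimately show ?thesis
      by simp
  qed

  \<comment> \<open>The last factor \<open>2 * exp 1\<close> arises because \<open>K j\<close> has
    at least \<open>exp (n j) / 2\<close> points while the divisor is
    \<open>exp (n j + 1)\<close>.\<close>
  define c where "c = exp (- 21 / 2) / (5 * sqrt (2 * pi)) / (2 * exp 1)"
  have "eventually (\<lambda>j. c * (1 / ((real (n j) + 1) * sqrt (ln (real (n j) + 1)))) \<le> expectation (Y j)) sequentially"
  proof -
    define F where "F x = 3 * x * sqrt (ln x)" for x :: real
    have "eventually (\<lambda>j. exp (1 - sqrt (ln (real j + 4)) / 2) * ln (F (real j + 4)) \<le> 1) sequentially"
      unfolding F_def by real_asymp
    moreover have "eventually (\<lambda>j. 2 \<le> ln (real j + 5)) sequentially"
      by real_asymp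
    ultimately show ?thesis
    proof eventually_elim
      case (elim j)
      define \<Lambda> where "\<Lambda> = ln (real (n j) + 1)"
      \<comment> \<open>\<open>a j\<close> is at most \<open>exp (sparse_shell j + 2)\<close> and
        \<open>k\<close> at least \<open>exp (n j)\<close>, so the gap of
        \<open>sqrt (ln (j + 4))\<close> gives \<open>a j \<le> r\<^sup>2 * k\<close>.\<close>
      define r where "r = exp (1 - sqrt (ln (real j + 4)) / 2)"
      define p where "p = exp (- 21 / 2) / (5 * sqrt (2 * pi)) / ((real (n j) + 1) * sqrt \<Lambda>)"
      have nj: "real j + 4 \<le> real (n j)" "real (n j) + 1 \<le> F (real j + 4)"
        using sparse_shell_bounds[of "Suc j"] by (auto simp: n_def F_def add_ac)
      have \<Lambda>: "2 \<le> \<Lambda>"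
        unfolding \<Lambda>_def using elim(2) nj(1) by (elim order.trans) (subst ln_le_cancel_iff; simp)
      have r: "0 \<le> r" "r * \<Lambda> \<le> 1"
      proof -
        have "\<Lambda> \<le> ln (F (real j + 4))"
          unfolding \<Lambda>_def using nj by (subst ln_le_cancel_iff) auto
        then have "r * \<Lambda> \<le> r * ln (F (real j + 4))"
          by (intro mult_left_mono) (auto simp: r_def)
        then show "r * \<Lambda> \<le> 1"
          using elim(1) unfolding r_def by linarith
      qed (simp add: r_def)
      have prob_ge: "p \<le> prob {\<omega>\<in>space M. \<theta> j k \<le> B (real k) \<omega> - B (real (a j)) \<omega>}" if k: "k \<in> K j" for k
      proof -
        have "real (a j) \<le> exp (real (sparse_shell j) + 2)"
          by (rule a_le)
        also have "\<dots> \<le> exp (2 - sqrt (ln (real j + 4)) + real (n j))"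
          using sparse_shell_gap[of j] by (simp add: n_def add_ac)
        also have "\<dots> = r\<^sup>2 * exp (real (n j))"
          unfolding r_def by (simp add: exp_add exp_of_nat_mult[symmetric] right_diff_distrib flip: exp_add)
        also have "\<dots> \<le> r\<^sup>2 * real k"
          using k by (intro mult_left_mono) (auto simp: K_def)
        finally have "real (a j) \<le> r\<^sup>2 * real k" .
        then show ?thesis
          unfolding p_def \<theta>_def \<Lambda>_def using k r \<Lambda> nj a_pos[of j]
          by (intro peak_prob_lower) (auto simp: K_def \<Lambda>_def)
      qed
      have meas: "{\<omega>\<in>space M. \<theta> j k \<le> B (real k) \<omega> - B (real (a j)) \<omega>} \<in> events" for k
        using increment_measurable[of "real (a j)" "real k"] by measurable
      have "Y j \<omega> = (\<Sum>k\<in>K j. indicator {\<omega>\<in>space M. \<theta> j k \<le> B (real k) \<omega> - B (real (a j)) \<omega>} \<omega>) / exp (real (n j) + 1)"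
        if "\<omega> \<in> space M" for \<omega>
        unfolding Y_eq using that by (intro arg_cong2[where f="(/)"] sum.cong refl) (auto simp: indicator_def)
      then have "expectation (Y j) = expectation (\<lambda>\<omega>. (\<Sum>k\<in>K j. indicator {\<omega>\<in>space M. \<theta> j k \<le> B (real k) \<omega> - B (real (a j)) \<omega>} \<omega>) / exp (real (n j) + 1))"
        by (intro Bochner_Integration.integral_cong) auto
      also have "\<dots> = (\<Sum>k\<in>K j. prob {\<omega>\<in>space M. \<theta> j k \<le> B (real k) \<omega> - B (real (a j)) \<omega>}) / exp (real (n j) + 1)"
        using meas by (subst integral_divide_zero, subst Bochner_Integration.integral_sum)
          (auto simp: emeasure_eq_measure)
      finally have E_eq: "expectation (Y j) = \<dots>" .
      have "c * (1 / ((real (n j) + 1) * sqrt \<Lambda>)) = p / (2 * exp 1)"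
        by (simp add: c_def p_def)
      also have "\<dots> = (exp (real (n j)) / 2) * p / exp (real (n j) + 1)"
        by (simp add: exp_add)
      also have "\<dots> \<le> (real (card (K j)) * p) / exp (real (n j) + 1)"
        using K_card_ge[of j] \<Lambda> by (intro divide_right_mono mult_right_mono) (auto simp: p_def)
      also have "\<dots> \<le> (\<Sum>k\<in>K j. prob {\<omega>\<in>space M. \<theta> j k \<le> B (real k) \<omega> - B (real (a j)) \<omega>}) / exp (real (n j) + 1)"
        using prob_ge by (intro divide_right_mono sum_bounded_below) auto
      finally show ?case
        unfolding E_eq \<Lambda>_def .
    qed
  qed
  then have ev: "eventually (\<lambda>j. norm (1 / ((real (n j) + 1) * sqrt (ln (real (n j) + 1)))) \<le> expectation (Y j) / c) sequentially"
  proof eventually_elim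
    case (elim j)
    moreover have "0 \<le> 1 / ((real (n j) + 1) * sqrt (ln (real (n j) + 1)))"
      by simp
    moreover have "0 < c"
      by (simp add: c_def)
    ultimately show ?case
      by (simp only: real_norm_def abs_of_nonneg pos_le_divide_eq mult.commute[of c])
  qed
  have "\<not> summable (\<lambda>j. expectation (Y j))"
  proof
    assume "summable (\<lambda>j. expectation (Y j))"
    then have "summable (\<lambda>j. expectation (Y j) / c)"
      by (rule summable_divide)
    with ev have "summable (\<lambda>j. 1 / ((real (n j) + 1) * sqrt (ln (real (n j) + 1))))"
      by (rule summable_comparison_test_ev)
    then show False
      using not_summable_sparse_shell by (simp add: n_def)
  qed
  then have "AE \<omega> in M. \<not> summable (\<lambda>j. Y j \<omega>)"
    using indep_Y Y_nonneg Y_le by (intro indep_bounded_not_summable)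
  moreover have "AE \<omega> in M. eventually (\<lambda>j. - (2 * sqrt (real (a j) * ln (real (Suc j)))) < B (real (a j)) \<omega>) sequentially"
    by (intro eventually_gt_neg_sqrt_ln a_pos)
  ultimately show ?thesis
  proof (eventually_elim, intro allI impI)
    fix \<omega> \<rho>
    assume nsum: "\<not> summable (\<lambda>j. Y j \<omega>)" and \<rho>: "0 < \<rho>" "\<rho> < (1::real)"
      and ev: "eventually (\<lambda>j. - (2 * sqrt (real (a j) * ln (real (Suc j)))) < B (real (a j)) \<omega>) sequentially"
    have "eventually (\<lambda>j. ennreal (Y j \<omega> / 2) \<le> macro_content \<rho> (Suc (n j)) (peaks 1 \<omega>)) sequentially"
      using ev
    proof eventually_elim
      case (elim j)
      define Q where "Q = {k\<in>K j. \<theta> j k \<le> B (real k) \<omega> - B (real (a j)) \<omega>}"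
      have QK: "Q \<subseteq> K j"
        by (auto simp: Q_def)
      have Y_card: "Y j \<omega> = real (card Q) / exp (real (n j) + 1)"
        unfolding Y_eq Q_def using K_fin[of j] by (simp add: sum.If_cases Int_def)
      have "real k \<in> peaks 1 \<omega> \<inter> macro_shell (Suc (n j))" if k: "k \<in> Q" for k
      proof
        have kK: "exp (real (n j)) \<le> real k" "real k < exp (real (n j) + 1)"
          using k QK by (auto simp: K_def)
        have "exp 1 \<le> real (n j)"
          using sparse_shell_bounds(1)[of "Suc j"] exp_le unfolding n_def by linarith
        then have "exp (exp 1) \<le> exp (real (n j))"
          by simp
        then have "exp (exp 1) \<le> real k"
          using kK(1) by (rule order.trans)
        \<comment> \<open>The extra term in \<theta> matches the eventual lower bound for
          \<open>B (a j)\<close>, so the path itself reaches the boundary.\<close>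
        moreover have "sqrt (2 * real k * ln (ln (real k))) \<le> B (real k) \<omega>"
          using k elim by (simp add: Q_def \<theta>_def)
        ultimately show "real k \<in> peaks 1 \<omega>"
          by (simp add: peaks_def)
        show "real k \<in> macro_shell (Suc (n j))"
          using nonneg_in_macro_shell_Suc[of "real k" "n j"] kK by (simp add: add.commute del: macro_shell.simps)
      qed
      moreover have "real (card Q) \<le> exp (real (Suc (n j)))"
        using order.trans[OF of_nat_mono[OF card_mono[OF K_fin QK]] K_card_le[of j]] by (simp add: add.commute)
      ultimately have "ennreal (real (card Q) / (2 * exp (real (Suc (n j))))) \<le> macro_content \<rho> (Suc (n j)) (peaks 1 \<omega>)"
        using \<rho> finite_subset[OF QK K_fin] by (intro macro_content_ge_nat) (auto simp del: macro_shell.simps)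
      then show ?case
        by (simp add: Y_card add.commute mult.commute)
    qed
    moreover have "inj n"
      using strict_mono_imp_inj_on[OF strict_mono_sparse_shell] by (auto simp: n_def inj_def)
    moreover have "\<not> summable (\<lambda>j. Y j \<omega> / 2)"
      using nsum summable_mult[of "\<lambda>j. Y j \<omega> / 2" 2] by auto
    ultimately show "(\<Sum>n. macro_content \<rho> (Suc n) (peaks 1 \<omega>)) = \<infinity>"
      using Y_nonneg by (intro suminf_ennreal_eq_top_of_subseq[where \<sigma>=n and y="\<lambda>j. Y j \<omega> / 2"]) auto
  qed
qed

text \<open>Lowering \<gamma> enlarges the peak set and its contents, so divergence at level 1
  carries over; 1 is also the largest possible dimension on the line.\<close>

lemma Dim_H_peaks:
  assumes \<gamma>: "\<gamma> \<le> 1"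
  shows "AE \<omega> in M. Dim_H (peaks \<gamma> \<omega>) = 1"
  using peaks_1_content
proof eventually_elim
  case (elim \<omega>)
  have sub: "peaks 1 \<omega> \<subseteq> peaks \<gamma> \<omega>"
  proof
    fix s assume s: "s \<in> peaks 1 \<omega>"
    then have e: "exp (exp 1) \<le> s"
      by (simp add: peaks_def)
    then have "0 < s"
      using exp_gt_zero[of "exp 1"] by linarith
    then have "exp 1 \<le> ln s"
      using e by (simp add: ln_ge_iff)
    then have "1 \<le> ln s"
      using exp_ge_add_one_self[of 1] by linarith
    then have "0 \<le> ln (ln s)"
      by simp
    then have "\<gamma> * sqrt (2 * s * ln (ln s)) \<le> 1 * sqrt (2 * s * ln (ln s))"
      using \<gamma> \<open>0 < s\<close> by (intro mult_right_mono) auto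
    then show "s \<in> peaks \<gamma> \<omega>"
      using s by (simp add: peaks_def)
  qed
  have mono: "macro_content \<rho> n (peaks 1 \<omega>) \<le> macro_content \<rho> n (peaks \<gamma> \<omega>)" for \<rho> n
    unfolding macro_content_def using sub by (intro Inf_superset_mono) blast
  have "ereal 1 \<le> Dim_H (peaks \<gamma> \<omega>)"
  proof (rule Dim_H_ge)
    fix \<rho> :: real assume "0 < \<rho>" "\<rho> < 1"
    then have "(\<Sum>n. macro_content \<rho> (Suc n) (peaks 1 \<omega>)) = \<infinity>"
      using elim by blast
    moreover have "(\<Sum>n. macro_content \<rho> (Suc n) (peaks 1 \<omega>)) \<le> (\<Sum>n. macro_content \<rho> (Suc n) (peaks \<gamma> \<omega>))"
      using mono by (intro suminf_le) auto
    ultimately show "(\<Sum>n. macro_content \<rho> (Suc n) (peaks \<gamma> \<omega>)) = \<infinity>"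
      by (simp add: top_unique)
  qed
  then show ?case
    using Dim_H_le_1[of "peaks \<gamma> \<omega>"] by (simp add: one_ereal_def)
qed

section \<open>Translation to the normalised quotients\<close>

text \<open>The restriction \<open>s \<ge> exp (exp 1)\<close> gives \<open>ln s > 1\<close>, so the
  denominator is positive and can be cleared.\<close>

lemma peaks_eq:
  "{s. exp (exp 1) \<le> s \<and> \<gamma> \<le> B s \<omega> / sqrt (2 * s * ln (ln s))} = peaks \<gamma> \<omega>"
proof -
  have "\<gamma> \<le> B s \<omega> / sqrt (2 * s * ln (ln s)) \<longleftrightarrow> \<gamma> * sqrt (2 * s * ln (ln s)) \<le> B s \<omega>" if e: "exp (exp 1) \<le> s" for s
  proof -
    have "0 < s"
      using exp_gt_zero[of "exp 1"] e by linarith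
    then have "exp 1 \<le> ln s"
      using e by (simp add: ln_ge_iff)
    then have "1 < ln s"
      using exp_ge_add_one_self[of 1] by linarith
    then have "0 < sqrt (2 * s * ln (ln s))"
      using \<open>0 < s\<close> ln_gt_zero[of "ln s"] by (simp add: zero_less_mult_iff)
    then show ?thesis
      by (rule pos_le_divide_eq)
  qed
  then show ?thesis
    by (auto simp: peaks_def)
qed

lemma OU_peaks_eq:
  "{u. exp (exp 1) \<le> u \<and> \<gamma> \<le> ornstein_uhlenbeck B u \<omega> / sqrt (2 * ln u)} = OU_peaks \<gamma> \<omega>"
proof -
  have "\<gamma> \<le> ornstein_uhlenbeck B u \<omega> / sqrt (2 * ln u) \<longleftrightarrow> \<gamma> * sqrt (2 * exp u * ln u) \<le> B (exp u) \<omega>" if e: "exp (exp 1) \<le> u" for u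
  proof -
    have "1 < u"
      using exp_ge_add_one_self[of "exp 1"] exp_gt_zero[of "1::real"] e by linarith
    then have pos: "0 < sqrt (2 * exp u * ln u)"
      by simp
    have "exp u = (exp (u / 2))\<^sup>2"
      by (simp add: exp_of_nat_mult[symmetric])
    then have "sqrt (exp u) = exp (u / 2)"
      by simp
    then have "ornstein_uhlenbeck B u \<omega> / sqrt (2 * ln u) = B (exp u) \<omega> / sqrt (2 * exp u * ln u)"
      by (simp add: ornstein_uhlenbeck_def real_sqrt_mult exp_minus field_simps)
    then show ?thesis
      using pos_le_divide_eq[OF pos] by simp
  qed
  then show ?thesis
    by (auto simp: OU_peaks_def)
qed

end

theorem theorem1p4:
  fixes M :: "'a measure" and B :: "real \<Rightarrow> 'a \<Rightarrow> real" and U :: "real \<Rightarrow> 'a \<Rightarrow> real"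
  assumes "standard_brownian_motion M B"
    and "U = ornstein_uhlenbeck B"
  shows "\<forall>\<gamma>>0.
    (AE \<omega> in M.
       Dim_H {s::real. s \<ge> exp (exp 1) \<and> B s \<omega> / sqrt (2 * s * ln (ln s)) \<ge> \<gamma>} =
         (if \<gamma> \<le> 1 then 1 else 0)) \<and>
    (AE \<omega> in M.
       if 1 - \<gamma>\<^sup>2 < 0
       then bounded {s::real. s \<ge> exp (exp 1) \<and> U s \<omega> / sqrt (2 * ln s) \<ge> \<gamma>}
       else Dim_H {s::real. s \<ge> exp (exp 1) \<and> U s \<omega> / sqrt (2 * ln s) \<ge> \<gamma>} = ereal (1 - \<gamma>\<^sup>2))"
proof (intro allI impI)
  fix \<gamma> :: real assume \<gamma>: "0 < \<gamma>"
  interpret standard_brownian_motion M B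
    by fact
  have sq: "1 - \<gamma>\<^sup>2 < 0 \<longleftrightarrow> 1 < \<gamma>"
    using \<gamma> power2_less_imp_less[of 1 \<gamma>] one_less_power[of \<gamma> 2] by auto
  show "(AE \<omega> in M.
       Dim_H {s::real. s \<ge> exp (exp 1) \<and> B s \<omega> / sqrt (2 * s * ln (ln s)) \<ge> \<gamma>} =
         (if \<gamma> \<le> 1 then 1 else 0)) \<and>
    (AE \<omega> in M.
       if 1 - \<gamma>\<^sup>2 < 0
       then bounded {s::real. s \<ge> exp (exp 1) \<and> U s \<omega> / sqrt (2 * ln s) \<ge> \<gamma>}
       else Dim_H {s::real. s \<ge> exp (exp 1) \<and> U s \<omega> / sqrt (2 * ln s) \<ge> \<gamma>} = ereal (1 - \<gamma>\<^sup>2))"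
    unfolding assms(2) peaks_eq OU_peaks_eq sq
  proof (cases "1 < \<gamma>")
    case True
    show "(AE \<omega> in M. Dim_H (peaks \<gamma> \<omega>) = (if \<gamma> \<le> 1 then 1 else 0)) \<and>
      (AE \<omega> in M. if 1 < \<gamma> then bounded (OU_peaks \<gamma> \<omega>) else Dim_H (OU_peaks \<gamma> \<omega>) = ereal (1 - \<gamma>\<^sup>2))"
      using bounded_peaks[OF True] True by (auto elim!: eventually_mono intro: Dim_H_bounded)
  next
    case False
    then have "AE \<omega> in M. Dim_H (OU_peaks \<gamma> \<omega>) \<le> ereal (1 - \<gamma>\<^sup>2)"
      using \<gamma> by (intro Dim_H_OU_peaks_le) auto
    moreover have "AE \<omega> in M. ereal (1 - \<gamma>\<^sup>2) \<le> Dim_H (OU_peaks \<gamma> \<omega>)"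
      using \<gamma> by (rule Dim_H_OU_peaks_ge)
    ultimately have "AE \<omega> in M. Dim_H (OU_peaks \<gamma> \<omega>) = ereal (1 - \<gamma>\<^sup>2)"
      by eventually_elim (rule antisym)
    then show "(AE \<omega> in M. Dim_H (peaks \<gamma> \<omega>) = (if \<gamma> \<le> 1 then 1 else 0)) \<and>
      (AE \<omega> in M. if 1 < \<gamma> then bounded (OU_peaks \<gamma> \<omega>) else Dim_H (OU_peaks \<gamma> \<omega>) = ereal (1 - \<gamma>\<^sup>2))"
      using False Dim_H_peaks[of \<gamma>] by auto
  qed
qed

end
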